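(* Let $\mu$ be an infinitely divisible distribution on $\mathbb{R}$ with characteristic triplet $(\sigma^2,\gamma,\nu)$, characteristic function $\varphi$ and symmetrized jump measure $\nu_s$. Assume that for some $\delta\in(0,1)$ the measure $x\,\nu_s(\mathrm{d}x)$ admits on $(0,\delta]$ a Lebesgue density $k_s$ with $k_s\in BV([\varepsilon,\delta])$ for all $\varepsilon\in(0,\delta)$, and that $\|(Dk_s)^+\|_{TV([0,\delta])}:=\lim_{\varepsilon\downarrow0}\|(Dk_s)^+\|_{TV([\varepsilon,\delta])}<\infty$. Then the following are equivalent: (i) $\sigma^2=0$ and $\|k_s\|_{BV([0,\delta])}<\infty$; (ii) $\sigma^2=0$ and $\lim_{x\to0}k_s(x)<\infty$; (iii) there are some $\alpha>0$ and some constant $c>0$ such that $|\varphi(u)|\ge c(1+|u|)^{-\alpha}$ for all $u\in\mathbb{R}$.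
   Context: An infinitely divisible distribution $\mu$ on $\mathbb{R}$ with characteristic triplet $(\sigma^2,\gamma,\nu)$ ($\sigma^2\ge0$, $\gamma\in\mathbb{R}$, $\nu$ a Lévy measure) has characteristic function $$\varphi(u)=\int e^{iux}\mu(\mathrm{d}x)=\exp\Big(-\tfrac{\sigma^2}{2}u^2+i\gamma u+\int\big(e^{iux}-1-iux\mathbf{1}_{[-1,1]}(x)\big)\nu(\mathrm{d}x)\Big),\quad u\in\mathbb{R}.$$ The symmetrized jump measure on $\mathbb{R}_+$ is $\nu_s(A):=\nu(A)+\nu(-A)$ for Borel sets $A\subseteq\mathbb{R}_+$ (note $\nu(\{0\})=0$). For a locally integrable function $f$ on an interval, if the distributional derivative of $f$ is a finite signed measure, this measure is denoted $Df$. $BV([a,b])$ is the space of such functions on $[a,b]$ (with $Df$ a finite signed measure on the interior of the interval), and $\|f\|_{BV([a,b])}:=\|Df\|_{TV([a,b])}$ is the total variation of $Df$ there. One has $Df((x,y])=f(y+)-f(x+)$. $(Df)^+$ and $(Df)^-$ denote the positive and negative parts of $Df$ in its Jordan decomposition, and $\|\rho\|_{TV}=\rho^+(\cdot)+\rho^-(\cdot)$ is total variation. If $k_s$ is only in $BV([\varepsilon,\delta])$ for each $\varepsilon>0$, then $\|k_s\|_{BV([0,\delta])}:=\lim_{\varepsilon\downarrow0}\|k_s\|_{BV([\varepsilon,\delta])}\in[0,\infty]$. The limit of $k_s$ at $0$ is the limit from the right, taken for the right-continuous version of $k_s$. *)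

theory Defs
  imports "HOL-Probability.Probability"
begin

section \<open>Infinitely divisible distributions\<close>

primrec convolution_power :: "real measure \<Rightarrow> nat \<Rightarrow> real measure" where
  "convolution_power M 0 = return borel 0"
| "convolution_power M (Suc n) = convolution M (convolution_power M n)"

definition infinitely_divisible :: "real measure \<Rightarrow> bool" where
  "infinitely_divisible \<mu> \<longleftrightarrow> real_distribution \<mu> \<and>
     (\<forall>n\<ge>1. \<exists>M. real_distribution M \<and> \<mu> = convolution_power M n)"

definition levy_measure :: "real measure \<Rightarrow> bool" where
  "levy_measure \<nu> \<longleftrightarrow> sets \<nu> = sets borel \<and> emeasure \<nu> {0} = 0 \<and>
     (\<integral>\<^sup>+ x. ennreal (min 1 (x\<^sup>2)) \<partial>\<nu>) < \<infinity>"

text \<open>The first argument after the distribution is the variance \<open>\<sigma>\<^sup>2\<close>, not its square root.\<close>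

definition has_characteristic_triplet ::
    "real measure \<Rightarrow> real \<Rightarrow> real \<Rightarrow> real measure \<Rightarrow> bool" where
  "has_characteristic_triplet \<mu> s2 \<gamma> \<nu> \<longleftrightarrow> s2 \<ge> 0 \<and> levy_measure \<nu> \<and>
     (\<forall>u. char \<mu> u =
        exp (- complex_of_real (s2 / 2 * u\<^sup>2) + \<i> * complex_of_real (\<gamma> * u) +
             (CLINT x|\<nu>. iexp (u * x) - 1 - \<i> * complex_of_real (u * x * indicator {-1..1} x))))"

definition symmetrized_jump_measure :: "real measure \<Rightarrow> real measure" where
  "symmetrized_jump_measure \<nu> =
     measure_of {0..} (sets (restrict_space borel {0..}))
       (\<lambda>A. emeasure \<nu> A + emeasure \<nu> (uminus ` A))"

text \<open>Confirms that the set function above is countably additive, so that \<^const>\<open>measure_of\<close>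
  does not fall back to the zero measure.\<close>

lemma emeasure_symmetrized_jump_measure:
  assumes \<nu>: "sets \<nu> = sets borel" and A: "A \<in> sets borel" "A \<subseteq> {0..}"
  shows "emeasure (symmetrized_jump_measure \<nu>) A = emeasure \<nu> A + emeasure \<nu> (uminus ` A)"
proof -
  let ?R = "restrict_space borel {0..} :: real measure"
  let ?f = "\<lambda>A. emeasure \<nu> A + emeasure \<nu> (uminus ` A)"
  have neg: "uminus ` B \<in> sets borel" if "B \<in> sets borel" for B :: "real set"
  proof -
    have "uminus ` B = uminus -` B \<inter> space borel"
      by (auto simp: image_iff) (metis minus_minus)
    then show ?thesis
      using measurable_sets[OF borel_measurable_uminus[OF measurable_ident] that] by simp
  qed
  have R: "B \<in> sets borel" if "B \<in> sets ?R" for B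
    using that by (auto simp: sets_restrict_space)
  have "positive (sets ?R) ?f"
    by (simp add: positive_def)
  moreover have "countably_additive (sets ?R) ?f"
  proof (rule countably_additiveI)
    fix B :: "nat \<Rightarrow> real set"
    assume B: "range B \<subseteq> sets ?R" "disjoint_family B"
    have Bi: "B i \<in> sets borel" for i using B R by auto
    have dn: "disjoint_family (\<lambda>i. uminus ` B i)"
      using B(2) by (fastforce simp: disjoint_family_on_def disjoint_iff)
    have "(\<Sum>i. ?f (B i)) = (\<Sum>i. emeasure \<nu> (B i)) + (\<Sum>i. emeasure \<nu> (uminus ` B i))"
      by (simp add: suminf_add)
    also have "(\<Sum>i. emeasure \<nu> (B i)) = emeasure \<nu> (\<Union>i. B i)"
      using Bi B(2) \<nu> by (intro suminf_emeasure) auto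
    also have "(\<Sum>i. emeasure \<nu> (uminus ` B i)) = emeasure \<nu> (\<Union>i. uminus ` B i)"
      using neg[OF Bi] dn \<nu> by (intro suminf_emeasure) auto
    finally show "(\<Sum>i. ?f (B i)) = ?f (\<Union>i. B i)"
      by (simp add: image_UN)
  qed
  moreover have "A \<in> sets ?R"
    using A by (auto simp: sets_restrict_space)
  moreover have "sigma_algebra {0..} (sets ?R)"
    using sets.sigma_algebra_axioms[of ?R] by (simp add: space_restrict_space)
  ultimately show ?thesis
    unfolding symmetrized_jump_measure_def by (intro emeasure_measure_of_sigma)
qed

text \<open>The measure \<open>x M(dx)\<close> has on \<open>S \<subseteq> {0..}\<close> the Lebesgue density \<open>k\<close>. The explicit sign condition
  is needed because \<^const>\<open>ennreal\<close> truncates negative values to zero.\<close>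

definition x_times_measure_has_density_on :: "real measure \<Rightarrow> real set \<Rightarrow> (real \<Rightarrow> real) \<Rightarrow> bool" where
  "x_times_measure_has_density_on M S k \<longleftrightarrow>
     k \<in> borel_measurable (restrict_space borel S) \<and>
     (AE x in lborel. x \<in> S \<longrightarrow> 0 \<le> k x) \<and>
     (\<forall>A\<in>sets borel. A \<subseteq> S \<longrightarrow>
        (\<integral>\<^sup>+ x\<in>A. ennreal x \<partial>M) = (\<integral>\<^sup>+ x\<in>A. ennreal (k x) \<partial>lborel))"

section \<open>Functions of bounded variation\<close>

definition locally_integrable_on :: "(real \<Rightarrow> real) \<Rightarrow> real set \<Rightarrow> bool" where
  "locally_integrable_on f S \<longleftrightarrow> (\<forall>K. compact K \<and> K \<subseteq> S \<longrightarrow> set_integrable lborel K f)"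

definition test_function_on :: "real set \<Rightarrow> (real \<Rightarrow> real) \<Rightarrow> bool" where
  "test_function_on S \<phi> \<longleftrightarrow>
     (\<forall>n x. (deriv ^^ n) \<phi> differentiable at x) \<and>
     compact (closure {x. \<phi> x \<noteq> 0}) \<and> closure {x. \<phi> x \<noteq> 0} \<subseteq> S"

definition mutually_singular :: "'a measure \<Rightarrow> 'a measure \<Rightarrow> bool" where
  "mutually_singular P N \<longleftrightarrow>
     (\<exists>S\<in>sets P. emeasure P S = 0 \<and> emeasure N (space P - S) = 0)"

text \<open>A finite signed measure is represented by its (unique) Jordan decomposition, a pair of
  mutually singular finite measures. The following says that the distributional derivative of \<open>f\<close>
  on the open interval \<open>(a, b)\<close> is the finite signed measure \<open>P - N\<close>, with Jordan decomposition
  \<open>(P, N)\<close>.\<close>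

definition is_distributional_derivative ::
    "real \<Rightarrow> real \<Rightarrow> (real \<Rightarrow> real) \<Rightarrow> real measure \<times> real measure \<Rightarrow> bool" where
  "is_distributional_derivative a b f = (\<lambda>(P, N).
     finite_measure P \<and> sets P = sets (restrict_space borel {a<..<b}) \<and>
     finite_measure N \<and> sets N = sets (restrict_space borel {a<..<b}) \<and>
     mutually_singular P N \<and>
     (\<forall>\<phi>. test_function_on {a<..<b} \<phi> \<longrightarrow>
        (LINT x:{a<..<b}|lborel. f x * deriv \<phi> x) = - ((LINT x|P. \<phi> x) - (LINT x|N. \<phi> x))))"

definition BV :: "real \<Rightarrow> real \<Rightarrow> (real \<Rightarrow> real) set" where
  "BV a b = {f. locally_integrable_on f {a..b} \<and> (\<exists>D. is_distributional_derivative a b f D)}"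

definition Df :: "real \<Rightarrow> real \<Rightarrow> (real \<Rightarrow> real) \<Rightarrow> real measure \<times> real measure" where
  "Df a b f = (THE D. is_distributional_derivative a b f D)"

abbreviation Df_pos :: "real \<Rightarrow> real \<Rightarrow> (real \<Rightarrow> real) \<Rightarrow> real measure" where
  "Df_pos a b f \<equiv> fst (Df a b f)"

abbreviation Df_neg :: "real \<Rightarrow> real \<Rightarrow> (real \<Rightarrow> real) \<Rightarrow> real measure" where
  "Df_neg a b f \<equiv> snd (Df a b f)"

text \<open>The positive part is a positive measure on \<open>(a, b)\<close>, so its total variation is its mass.\<close>

definition Df_pos_norm :: "real \<Rightarrow> real \<Rightarrow> (real \<Rightarrow> real) \<Rightarrow> ennreal" where
  "Df_pos_norm a b f = emeasure (Df_pos a b f) {a<..<b}"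

definition BV_norm :: "real \<Rightarrow> real \<Rightarrow> (real \<Rightarrow> real) \<Rightarrow> ennreal" where
  "BV_norm a b f = emeasure (Df_pos a b f) {a<..<b} + emeasure (Df_neg a b f) {a<..<b}"

text \<open>The versions on \<open>[0, b]\<close> for functions that are only of bounded variation away from \<open>0\<close>;
  the limits exist in \<open>[0, \<infinity>]\<close> for such functions by monotonicity.\<close>

definition Df_pos_norm0 :: "real \<Rightarrow> (real \<Rightarrow> real) \<Rightarrow> ennreal" where
  "Df_pos_norm0 b f = Lim (at_right 0) (\<lambda>\<epsilon>. Df_pos_norm \<epsilon> b f)"

definition BV_norm0 :: "real \<Rightarrow> (real \<Rightarrow> real) \<Rightarrow> ennreal" where
  "BV_norm0 b f = Lim (at_right 0) (\<lambda>\<epsilon>. BV_norm \<epsilon> b f)"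

definition right_continuous_version_on ::
    "real \<Rightarrow> real \<Rightarrow> (real \<Rightarrow> real) \<Rightarrow> (real \<Rightarrow> real) \<Rightarrow> bool" where
  "right_continuous_version_on a b f g \<longleftrightarrow>
     (AE x in lborel. x \<in> {a<..<b} \<longrightarrow> g x = f x) \<and>
     (\<forall>x\<in>{a<..<b}. continuous (at_right x) g)"

text \<open>\<open>lim f(x) < \<infinity>\<close> as \<open>x\<close> decreases to \<open>0\<close>, taken along the right-continuous version of \<open>f\<close>, whose
  values on \<open>(0, b)\<close> are uniquely determined. A real limit is required: a limit of \<open>-\<infinity>\<close> cannot
  occur for the almost everywhere nonnegative densities this is applied to.\<close>

definition finite_limit_at_0 :: "real \<Rightarrow> (real \<Rightarrow> real) \<Rightarrow> bool" where
  "finite_limit_at_0 b f \<longleftrightarrow>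
     (\<exists>g. right_continuous_version_on 0 b f g \<and> (\<exists>l. (g \<longlongrightarrow> l) (at_right 0)))"

end

theory Submission
  imports Defs "HOL-Real_Asymp.Real_Asymp"
begin

text \<open>
  The triplet formula gives \<open>\<bar>\<phi>(u)\<bar> = exp (- \<sigma>\<^sup>2 u\<^sup>2 / 2 - J u)\<close> with
  \<open>J u = \<integral> (1 - cos (u x)) \<nu>(dx)\<close> (lemma \<open>cmod_char_eq\<close>). The integrand is even, so near \<open>0\<close>
  the integral only depends on the density \<open>k\<^sub>s\<close> and becomes \<open>\<integral> (1 - cos (u x)) k\<^sub>s(x) / x dx\<close>
  (\<open>nn_integral_levy_eq_density\<close>). For a constant density \<open>K\<close> this grows like \<open>K ln u\<close>. Hence a
  density bounded near \<open>0\<close> yields at most logarithmic growth of \<open>J\<close>, so that \<open>\<bar>\<phi>\<bar>\<close>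
  decays at most polynomially (\<open>levy_exponent_upper_bound\<close>), while a density that eventually exceeds every constant
  makes \<open>J\<close> grow faster than every multiple of \<open>ln u\<close> (\<open>levy_exponent_lower_bound\<close>), and a
  Gaussian part makes the exponent grow quadratically.

  It remains to see that finite variation and infinite growth at \<open>0\<close> are the only alternatives.
  A function whose distributional derivative on an interval is \<open>P - N\<close> agrees almost everywhere
  with the difference of the distribution functions of \<open>P\<close> and \<open>N\<close> up to a constant
  (\<open>BV_representation\<close>). Counting mass from the right end point this reads
  \<open>k\<^sub>s(x) = C - p(x) + n(x)\<close> almost everywhere on \<open>(0, \<delta>)\<close>, where \<open>p(x)\<close> and \<open>n(x)\<close> are the
  masses of \<open>(Dk\<^sub>s)\<^sup>+\<close> and \<open>(Dk\<^sub>s)\<^sup>-\<close> on \<open>(x, \<delta>)\<close>. Both increase as \<open>x\<close> decreases to \<open>0\<close>,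
  and \<open>p\<close> stays bounded by assumption. If \<open>n\<close> is bounded as well, the variation is finite and
  the right-hand side is a right-continuous version with a finite limit at \<open>0\<close>; if not, the variation
  is infinite and \<open>k\<^sub>s\<close> tends to infinity. This closes the circle (i), (ii), (iii), (i).

  The representation rests on two facts about test functions on an interval: they separate finite
  signed measures (\<open>measures_agree_if_bump_integrals_agree\<close>), which also makes the distributional
  derivative unique and compatible with restriction to smaller intervals, and a function that
  annihilates all their derivatives is constant (\<open>du_Bois_Reymond\<close>). Both are proved with explicit smooth bump
  functions that converge to the indicator of an open interval.
\<close>

section \<open>Smooth bump functions\<close>

text \<open>The family of all \<open>p(1/y) exp(- 1/y)\<close>, extended by \<open>0\<close> to \<open>y \<le> 0\<close>, is closed under
  differentiation; allowing a polynomial factor is what makes smoothness a one-step induction.\<close>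
definition flat :: "real poly \<Rightarrow> real \<Rightarrow> real" where
  "flat p y = (if 0 < y then poly p (1 / y) * exp (- (1 / y)) else 0)"

lemma poly_times_exp_minus_tendsto_0:
  "((\<lambda>t::real. poly p t * exp (- t)) \<longlongrightarrow> 0) at_top"
proof -
  have "((\<lambda>t::real. \<Sum>i\<le>degree p. coeff p i * (t ^ i / exp t)) \<longlongrightarrow>
      (\<Sum>i\<le>degree p. coeff p i * 0)) at_top"
    by (intro tendsto_intros tendsto_power_div_exp_0)
  then show ?thesis
    by (simp add: poly_altdef sum_distrib_right exp_minus divide_inverse mult.assoc)
qed

lemma flat_tendsto_0: "(flat p \<longlongrightarrow> 0) (at_right 0)"
proof -
  have "((\<lambda>y. poly p (inverse y) * exp (- inverse y)) \<longlongrightarrow> 0) (at_right (0::real))"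
    using filterlim_compose[OF poly_times_exp_minus_tendsto_0 filterlim_inverse_at_top_right] .
  then show ?thesis
    by (rule Lim_transform_eventually)
      (auto simp: eventually_at_filter flat_def divide_inverse)
qed

text \<open>With \<open>t = 1/y\<close> the chain rule gives \<open>(p(t) - p'(t)) t\<^sup>2 exp(- t)\<close>. At \<open>0\<close> the difference
  quotient is again a member of the family, and it tends to \<open>0\<close> because the exponential wins.\<close>
lemma flat_has_derivative:
  "(flat p has_real_derivative flat ([:0, 0, 1:] * (p - pderiv p)) y) (at y)"
proof (cases y "0::real" rule: linorder_cases)
  case less
  have "((\<lambda>_. 0) has_real_derivative 0) (at y)" by simp
  then have "(flat p has_real_derivative 0) (at y)"
    by (rule has_field_derivative_transform_within[where d = "- y"])
      (use less in \<open>auto simp: flat_def dist_real_def\<close>)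
  then show ?thesis using less by (simp add: flat_def)
next
  case greater
  have "((\<lambda>y. poly p (1 / y) * exp (- (1 / y))) has_real_derivative
      flat ([:0, 0, 1:] * (p - pderiv p)) y) (at y)"
    using greater
    by (auto intro!: derivative_eq_intros simp: flat_def field_simps power2_eq_square)
  then show ?thesis
    by (rule has_field_derivative_transform_within[where d = y])
      (use greater in \<open>auto simp: flat_def dist_real_def\<close>)
next
  case equal
  have "((\<lambda>h. (flat p (0 + h) - flat p 0) / h) \<longlongrightarrow> 0) (at_right 0)"
  proof (rule Lim_transform_eventually[OF flat_tendsto_0[of "[:0, 1:] * p"]])
    show "\<forall>\<^sub>F h in at_right 0. flat ([:0, 1:] * p) h = (flat p (0 + h) - flat p 0) / h"
      by (auto simp: eventually_at_filter flat_def)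
  qed
  moreover have "((\<lambda>h. (flat p (0 + h) - flat p 0) / h) \<longlongrightarrow> 0) (at_left 0)"
    by (rule Lim_transform_eventually[OF tendsto_const])
      (auto simp: eventually_at_filter flat_def)
  ultimately show ?thesis
    using equal by (simp add: DERIV_def filterlim_at_split flat_def)
qed

text \<open>An algebra of functions that is stable under differentiation, so that all its members are
  smooth. It holds the bump functions, and linear combinations of them stay inside.\<close>
inductive_set flat_algebra :: "(real \<Rightarrow> real) set" where
  base: "(\<lambda>x. flat p (r * x + s)) \<in> flat_algebra"
| scale: "f \<in> flat_algebra \<Longrightarrow> (\<lambda>x. r * f x) \<in> flat_algebra"
| add: "f \<in> flat_algebra \<Longrightarrow> g \<in> flat_algebra \<Longrightarrow> (\<lambda>x. f x + g x) \<in> flat_algebra"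
| mult: "f \<in> flat_algebra \<Longrightarrow> g \<in> flat_algebra \<Longrightarrow> (\<lambda>x. f x * g x) \<in> flat_algebra"

lemma flat_algebra_has_derivative:
  assumes "f \<in> flat_algebra"
  shows "\<exists>f'\<in>flat_algebra. \<forall>x. (f has_real_derivative f' x) (at x)"
  using assms
proof induction
  case (base p r s)
  have "((\<lambda>x. flat p (r * x + s)) has_real_derivative
      r * flat ([:0, 0, 1:] * (p - pderiv p)) (r * x + s)) (at x)" for x
  proof -
    have "((\<lambda>x. r * x + s) has_real_derivative r) (at x)"
      by (auto intro!: derivative_eq_intros)
    from DERIV_chain2[OF flat_has_derivative this] show ?thesis
      by (simp only: mult.commute)
  qed
  then show ?case
    by (intro bexI[OF _ flat_algebra.scale[OF flat_algebra.base]] allI)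
next
  case (scale f r)
  then obtain f' where "f' \<in> flat_algebra" "\<And>x. (f has_real_derivative f' x) (at x)"
    by blast
  then show ?case
    by (intro bexI[of _ "\<lambda>x. r * f' x"])
      (auto intro!: derivative_eq_intros flat_algebra.intros)
next
  case (add f g)
  then obtain f' g' where "f' \<in> flat_algebra" "\<And>x. (f has_real_derivative f' x) (at x)"
    "g' \<in> flat_algebra" "\<And>x. (g has_real_derivative g' x) (at x)"
    by blast
  then show ?case
    by (intro bexI[of _ "\<lambda>x. f' x + g' x"])
      (auto intro!: derivative_eq_intros flat_algebra.intros)
next
  case (mult f g)
  then obtain f' g' where "f' \<in> flat_algebra" "\<And>x. (f has_real_derivative f' x) (at x)"
    "g' \<in> flat_algebra" "\<And>x. (g has_real_derivative g' x) (at x)"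
    by blast
  then show ?case
    using mult.hyps
    by (intro bexI[of _ "\<lambda>x. f' x * g x + f x * g' x"])
      (auto intro!: derivative_eq_intros flat_algebra.intros simp: algebra_simps)
qed

lemma deriv_flat_algebra: "f \<in> flat_algebra \<Longrightarrow> deriv f \<in> flat_algebra"
proof -
  assume "f \<in> flat_algebra"
  then obtain f' where "f' \<in> flat_algebra" "\<And>x. (f has_real_derivative f' x) (at x)"
    using flat_algebra_has_derivative by blast
  moreover from this(2) have "deriv f = f'"
    by (auto intro!: ext DERIV_imp_deriv)
  ultimately show ?thesis by simp
qed

lemma flat_algebra_differentiable:
  assumes "f \<in> flat_algebra"
  shows "(deriv ^^ n) f differentiable at x"
proof -
  have "(deriv ^^ n) f \<in> flat_algebra"
    by (induction n) (auto intro: assms deriv_flat_algebra)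
  then show ?thesis
    using flat_algebra_has_derivative real_differentiable_def by blast
qed

lemma flat_algebra_continuous: "f \<in> flat_algebra \<Longrightarrow> continuous_on S f"
  by (drule flat_algebra_has_derivative)
    (metis DERIV_isCont continuous_at_imp_continuous_on)

text \<open>For \<open>c < x < d\<close> both arguments of \<^const>\<open>flat\<close> grow to infinity with \<open>n\<close>, where
  \<open>exp(- 1/y)\<close> tends to \<open>1\<close>. Subtracting \<open>1\<close> pushes the support into
  \<open>[c + 1/(n+1), d - 1/(n+1)]\<close>: then \<open>c\<close> and \<open>d\<close> may be the end points of the
  interval on which test functions are required to have compact support.\<close>
definition bump :: "nat \<Rightarrow> real \<Rightarrow> real \<Rightarrow> real \<Rightarrow> real" where
  "bump n c d x = flat 1 (real (Suc n) * (x - c) - 1) * flat 1 (real (Suc n) * (d - x) - 1)"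

lemma bump_in_flat_algebra: "bump n c d \<in> flat_algebra"
proof -
  have "(\<lambda>x. flat 1 (real (Suc n) * x + (- real (Suc n) * c - 1)) *
      flat 1 ((- real (Suc n)) * x + (real (Suc n) * d - 1))) \<in> flat_algebra"
    by (intro flat_algebra.intros)
  also have "(\<lambda>x. flat 1 (real (Suc n) * x + (- real (Suc n) * c - 1)) *
      flat 1 ((- real (Suc n)) * x + (real (Suc n) * d - 1))) = bump n c d"
    by (auto simp: bump_def algebra_simps)
  finally show ?thesis .
qed

lemma bump_measurable [measurable]: "bump n c d \<in> borel_measurable borel"
  by (intro borel_measurable_continuous_onI flat_algebra_continuous bump_in_flat_algebra)

lemma bump_bounds: "0 \<le> bump n c d x" "bump n c d x \<le> 1"
proof -
  have "0 \<le> flat 1 y" "flat 1 y \<le> 1" for y by (auto simp: flat_def)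
  then show "0 \<le> bump n c d x" "bump n c d x \<le> 1"
    by (auto simp: bump_def intro: mult_le_one)
qed

lemma bump_eq_0:
  assumes "x \<notin> {c + 1 / real (Suc n)..d - 1 / real (Suc n)}"
  shows "bump n c d x = 0"
proof -
  have "\<not> 0 < real (Suc n) * (x - c) - 1 \<or> \<not> 0 < real (Suc n) * (d - x) - 1"
    using assms by (auto simp: field_simps)
  then show ?thesis by (auto simp: bump_def flat_def)
qed

lemma bump_eq_0': "x \<notin> {c<..<d} \<Longrightarrow> bump n c d x = 0"
proof (rule bump_eq_0)
  assume "x \<notin> {c<..<d}"
  moreover have "0 < 1 / real (Suc n)" by simp
  ultimately show "x \<notin> {c + 1 / real (Suc n)..d - 1 / real (Suc n)}"
    unfolding atLeastAtMost_iff greaterThanLessThan_iff by linarith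
qed

lemma bump_tendsto_indicator:
  "(\<lambda>n. bump n c d x) \<longlonglongrightarrow> indicator {c<..<d} x"
proof (cases "x \<in> {c<..<d}")
  case False
  then show ?thesis by (simp add: bump_eq_0')
next
  case True
  have *: "(\<lambda>n. flat 1 (real (Suc n) * y - 1)) \<longlonglongrightarrow> 1" if "0 < y" for y
  proof -
    have lim: "filterlim (\<lambda>n. real (Suc n) * y - 1) at_top sequentially"
      using that by real_asymp
    then have "((\<lambda>n. exp (- (1 / (real (Suc n) * y - 1)))) \<longlongrightarrow> exp (- 0)) sequentially"
      by (intro tendsto_exp tendsto_minus tendsto_divide_0[OF tendsto_const]
          filterlim_at_top_imp_at_infinity)
    moreover have "\<forall>\<^sub>F n in sequentially. exp (- (1 / (real (Suc n) * y - 1))) =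
        flat 1 (real (Suc n) * y - 1)"
      using filterlim_at_top_dense[THEN iffD1, OF lim, rule_format, of 0]
      by eventually_elim (simp add: flat_def)
    ultimately show ?thesis
      by (simp add: tendsto_cong)
  qed
  have "(\<lambda>n. bump n c d x) \<longlonglongrightarrow> 1 * 1"
    unfolding bump_def using True by (intro tendsto_mult *) auto
  then show ?thesis using True by simp
qed

lemma test_function_onI:
  assumes "\<And>n x. (deriv ^^ n) \<phi> differentiable at x"
    and "\<And>x. x \<notin> {l..r} \<Longrightarrow> \<phi> x = 0" and "a < l" "r < b"
  shows "test_function_on {a<..<b} \<phi>"
proof -
  have *: "closure {x. \<phi> x \<noteq> 0} \<subseteq> {l..r}"
    using assms(2) by (intro closure_minimal) (blast, simp)
  then have "compact (closure {x. \<phi> x \<noteq> 0})"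
    by (metis closed_closure compact_Icc compact_Int_closed inf.absorb_iff2)
  with * show ?thesis
    using assms(1,3,4) unfolding test_function_on_def by fastforce
qed

lemma test_function_bump:
  assumes "a \<le> c" "d \<le> b"
  shows "test_function_on {a<..<b} (bump n c d)"
proof (rule test_function_onI[OF flat_algebra_differentiable[OF bump_in_flat_algebra] bump_eq_0])
  have "0 < 1 / real (Suc n)" by simp
  then show "a < c + 1 / real (Suc n)" "d - 1 / real (Suc n) < b"
    using assms by linarith+
qed

section \<open>Uniqueness of the distributional derivative\<close>

lemma integral_bump_tendsto:
  assumes [measurable_cong]: "sets M = sets borel" and "emeasure M {c<..<d} < \<infinity>"
  shows "(\<lambda>n. LINT x|M. bump n c d x) \<longlonglongrightarrow> measure M {c<..<d}"
proof -
  have "(\<lambda>n. LINT x|M. bump n c d x) \<longlonglongrightarrow> (LINT x|M. indicator {c<..<d} x)"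
  proof (rule integral_dominated_convergence[where w = "indicator {c<..<d}"])
    show "integrable M (indicator {c<..<d} :: real \<Rightarrow> real)"
      using assms by (simp add: integrable_indicator_iff)
    show "AE x in M. norm (bump n c d x) \<le> indicator {c<..<d} x" for n
      using bump_bounds[of n c d] bump_eq_0'[of _ c d n]
      by (intro AE_I2) (auto simp: indicator_def simp del: greaterThanLessThan_iff)
  qed (auto simp: bump_tendsto_indicator)
  then show ?thesis using sets_eq_imp_space_eq[OF assms(1)] by simp
qed

lemma borel_eq_open_interval: "borel = sigma UNIV (range (\<lambda>(a, b). {a<..<b::real}))"
  unfolding box_real(1)[symmetric] by (rule borel_eq_box)

text \<open>Bump functions tend boundedly to indicators of open intervals, so the two sides agree on
  open intervals, hence on all Borel sets by the \<open>\<pi>\<close>-\<open>\<lambda>\<close> theorem. Sums of two measures on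
  either side stand for equality of signed measures, \<open>A1 - B2 = B1 - A2\<close>.\<close>
lemma measures_agree_if_bump_integrals_agree:
  fixes A1 A2 B1 B2 :: "real measure"
  assumes M: "\<And>M. M \<in> {A1, A2, B1, B2} \<Longrightarrow>
      finite_measure M \<and> sets M = sets borel \<and> measure M (- {a<..<b}) = 0"
    and int: "\<And>n c d. a \<le> c \<Longrightarrow> d \<le> b \<Longrightarrow>
      (LINT x|A1. bump n c d x) + (LINT x|A2. bump n c d x) =
      (LINT x|B1. bump n c d x) + (LINT x|B2. bump n c d x)"
    and S: "S \<in> sets borel"
  shows "measure A1 S + measure A2 S = measure B1 S + measure B2 S"
proof -
  have fin: "finite_measure M" and sets: "sets M = sets borel" and space: "space M = UNIV"
    if "M \<in> {A1, A2, B1, B2}" for M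
    using M[OF that] by (auto dest: sets_eq_imp_space_eq)
  have restrict: "measure M S = measure M (S \<inter> {a<..<b})"
    if "M \<in> {A1, A2, B1, B2}" "S \<in> sets borel" for M S
  proof -
    interpret finite_measure M using fin[OF that(1)] .
    have "measure M S = measure M (S \<inter> {a<..<b}) + measure M (S - {a<..<b})"
      using that sets[OF that(1)] by (subst finite_measure_Union[symmetric]) (auto simp: Int_Diff_Un)
    moreover have "measure M (S - {a<..<b}) \<le> measure M (- {a<..<b})"
      using sets[OF that(1)] by (intro finite_measure_mono) auto
    ultimately show ?thesis
      using M[OF that(1)] by (simp add: measure_le_0_iff)
  qed
  have basic: "measure A1 {c<..<d} + measure A2 {c<..<d} =
      measure B1 {c<..<d} + measure B2 {c<..<d}" for c d
  proof -
    let ?c = "max a c" and ?d = "min b d"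
    have lim: "(\<lambda>n. LINT x|M. bump n ?c ?d x) \<longlonglongrightarrow> measure M {c<..<d}"
      if "M \<in> {A1, A2, B1, B2}" for M
    proof -
      have "{c<..<d} \<inter> {a<..<b} = {?c<..<?d}" by auto
      then show ?thesis
        using integral_bump_tendsto[OF sets[OF that], of ?c ?d]
          restrict[OF that, of "{c<..<d}"] finite_measure.emeasure_finite[OF fin[OF that]]
        by (simp add: less_top)
    qed
    have "(\<lambda>n. (LINT x|A1. bump n ?c ?d x) + (LINT x|A2. bump n ?c ?d x)) \<longlonglongrightarrow>
        measure A1 {c<..<d} + measure A2 {c<..<d}"
      by (intro tendsto_add lim) auto
    moreover have "(\<lambda>n. (LINT x|A1. bump n ?c ?d x) + (LINT x|A2. bump n ?c ?d x)) \<longlonglongrightarrow>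
        measure B1 {c<..<d} + measure B2 {c<..<d}"
      by (subst int) (auto intro!: tendsto_add lim)
    ultimately show ?thesis by (rule LIMSEQ_unique)
  qed
  let ?G = "range (\<lambda>(a, b). {a<..<b::real})"
  have "Int_stable ?G" "?G \<subseteq> Pow UNIV"
    by (force intro!: Int_stableI)+
  moreover have "S \<in> sigma_sets UNIV ?G"
    using S by (subst (asm) borel_eq_open_interval) simp
  ultimately show ?thesis
  proof (induct rule: sigma_sets_induct_disjoint)
    case (basic X)
    then show ?case using \<open>\<And>c d. _ c d = _ c d\<close> by auto
  next
    case (compl X)
    have X: "X \<in> sets borel"
      using compl(1) by (subst borel_eq_open_interval) simp
    have "measure M (UNIV - X) = measure M {a<..<b} - measure M X"
      if "M \<in> {A1, A2, B1, B2}" for M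
      using finite_measure.finite_measure_compl[OF fin[OF that], of X]
        restrict[OF that, of UNIV] sets[OF that] space[OF that] X by simp
    then show ?case using compl(2) basic[of a b] by simp
  next
    case (union X)
    have X: "X i \<in> sets borel" for i
      using union(2) by (subst borel_eq_open_interval) auto
    have sums: "(\<lambda>i. measure M (X i)) sums measure M (\<Union>i. X i)"
      if "M \<in> {A1, A2, B1, B2}" for M
      using finite_measure.finite_measure_UNION[OF fin[OF that], of X] sets[OF that] X union(1)
      by auto
    have "(\<lambda>i. measure A1 (X i) + measure A2 (X i)) sums
        (measure A1 (\<Union>i. X i) + measure A2 (\<Union>i. X i))"
      by (intro sums_add sums) auto
    moreover have "(\<lambda>i. measure A1 (X i) + measure A2 (X i)) sums
        (measure B1 (\<Union>i. X i) + measure B2 (\<Union>i. X i))"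
      by (subst union(3)) (auto intro!: sums_add sums)
    ultimately show ?case by (rule sums_unique2)
  next
    case empty
    show ?case by simp
  qed
qed

text \<open>Measures on \<open>(a, b)\<close> are moved to the whole line because distribution functions and the
  agreement lemma above are about Borel measures on the reals.\<close>
definition extend_by_0 :: "real measure \<Rightarrow> real measure" where
  "extend_by_0 M = distr M borel (\<lambda>x. x)"

locale finite_measure_on_interval = finite_measure M for M :: "real measure" +
  fixes a b :: real
  assumes sets_eq: "sets M = sets (restrict_space borel {a<..<b})"
begin

lemma space_eq: "space M = {a<..<b}"
  using sets_eq_imp_space_eq[OF sets_eq] by (simp add: space_restrict_space)

lemma sets_iff: "S \<in> sets M \<longleftrightarrow> S \<in> sets borel \<and> S \<subseteq> {a<..<b}"
  unfolding sets_eq by (subst sets_restrict_space_iff) auto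

lemma borel_measurableI: "f \<in> borel_measurable borel \<Longrightarrow> f \<in> borel_measurable M"
  by (simp add: measurable_cong_sets[OF sets_eq refl] measurable_restrict_space1)

lemma finite_measure_extend_by_0: "finite_measure (extend_by_0 M)"
  unfolding extend_by_0_def by (intro finite_measure_distr borel_measurableI) simp

lemma sets_extend_by_0: "sets (extend_by_0 M) = sets borel"
  by (simp add: extend_by_0_def)

lemma measure_extend_by_0:
  "S \<in> sets borel \<Longrightarrow> measure (extend_by_0 M) S = measure M (S \<inter> {a<..<b})"
  unfolding extend_by_0_def by (subst measure_distr) (auto simp: space_eq borel_measurableI)

lemma integral_extend_by_0:
  fixes f :: "real \<Rightarrow> real"
  assumes "f \<in> borel_measurable borel"
  shows "(LINT x|extend_by_0 M. f x) = (LINT x|M. f x)"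
  unfolding extend_by_0_def
  using assms by (intro integral_distr borel_measurableI) auto

end

lemma is_distributional_derivative_iff:
  "is_distributional_derivative a b f (P, N) \<longleftrightarrow>
     finite_measure_on_interval P a b \<and> finite_measure_on_interval N a b \<and>
     mutually_singular P N \<and>
     (\<forall>\<phi>. test_function_on {a<..<b} \<phi> \<longrightarrow>
        (LINT x:{a<..<b}|lborel. f x * deriv \<phi> x) = - ((LINT x|P. \<phi> x) - (LINT x|N. \<phi> x)))"
  unfolding is_distributional_derivative_def finite_measure_on_interval_def
    finite_measure_on_interval_axioms_def prod.case
  by (rule iffI; elim conjE; intro conjI; assumption)

text \<open>The positive part of a Jordan decomposition is the least one: outside the \<open>P\<close>-null set that
  carries \<open>N\<close>, the equation reads \<open>P + N' = P'\<close>.\<close>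
lemma Jordan_positive_part_le:
  assumes sing: "mutually_singular P N"
    and fin: "finite_measure_on_interval P a b" "finite_measure_on_interval N a b"
      "finite_measure_on_interval P' a b"
    and sum: "\<And>E. E \<in> sets borel \<Longrightarrow> E \<subseteq> {a<..<b} \<Longrightarrow>
      measure P E + measure N' E = measure P' E + measure N E"
    and E: "E \<in> sets borel" "E \<subseteq> {a<..<b}"
  shows "measure P E \<le> measure P' E"
proof -
  interpret P: finite_measure_on_interval P a b by fact
  interpret N: finite_measure_on_interval N a b by fact
  interpret P': finite_measure_on_interval P' a b by fact
  obtain S where S: "S \<in> sets P" "measure P S = 0" "measure N ({a<..<b} - S) = 0"
    using sing unfolding mutually_singular_def P.space_eq
    by (auto simp: P.emeasure_eq_measure N.emeasure_eq_measure)
  have "measure P E \<le> measure P (E - S) + measure P S"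
    using E S(1) P.sets_iff
    by (intro order_trans[OF P.finite_measure_mono measure_Un_le]) auto
  moreover have "measure N (E - S) \<le> measure N ({a<..<b} - S)"
    using E S(1) P.sets_iff N.sets_iff by (intro N.finite_measure_mono) auto
  moreover have "measure P' (E - S) \<le> measure P' E"
    using E S(1) P.sets_iff P'.sets_iff by (intro P'.finite_measure_mono) auto
  moreover have "measure P (E - S) + measure N' (E - S) = measure P' (E - S) + measure N (E - S)"
    using E S(1) P.sets_iff by (intro sum) auto
  ultimately show ?thesis
    using S measure_nonneg[of N' "E - S"] by linarith
qed

lemma is_distributional_derivative_unique:
  assumes D: "is_distributional_derivative a b f (P, N)"
    and D': "is_distributional_derivative a b f (P', N')"
  shows "P = P'" "N = N'"
proof -
  interpret P: finite_measure_on_interval P a b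
    using D by (simp add: is_distributional_derivative_iff)
  interpret N: finite_measure_on_interval N a b
    using D by (simp add: is_distributional_derivative_iff)
  interpret P': finite_measure_on_interval P' a b
    using D' by (simp add: is_distributional_derivative_iff)
  interpret N': finite_measure_on_interval N' a b
    using D' by (simp add: is_distributional_derivative_iff)
  have sum: "measure P E + measure N' E = measure P' E + measure N E"
    if E: "E \<in> sets borel" "E \<subseteq> {a<..<b}" for E
  proof -
    have "measure (extend_by_0 P) E + measure (extend_by_0 N') E =
        measure (extend_by_0 P') E + measure (extend_by_0 N) E"
    proof (rule measures_agree_if_bump_integrals_agree[OF _ _ E(1)])
      show "finite_measure M \<and> sets M = sets borel \<and> measure M (- {a<..<b}) = 0"
        if "M \<in> {extend_by_0 P, extend_by_0 N', extend_by_0 P', extend_by_0 N}" for M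
        using that P.finite_measure_extend_by_0 N.finite_measure_extend_by_0
          P'.finite_measure_extend_by_0 N'.finite_measure_extend_by_0
        by (auto simp: P.sets_extend_by_0 N.sets_extend_by_0 P'.sets_extend_by_0
            N'.sets_extend_by_0 P.measure_extend_by_0 N.measure_extend_by_0
            P'.measure_extend_by_0 N'.measure_extend_by_0)
      show "(LINT x|extend_by_0 P. bump n c d x) + (LINT x|extend_by_0 N'. bump n c d x) =
          (LINT x|extend_by_0 P'. bump n c d x) + (LINT x|extend_by_0 N. bump n c d x)"
        if "a \<le> c" "d \<le> b" for n c d
      proof -
        note t = test_function_bump[OF that, of n]
        have "- ((LINT x|P. bump n c d x) - (LINT x|N. bump n c d x)) =
            - ((LINT x|P'. bump n c d x) - (LINT x|N'. bump n c d x))"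
          using D[unfolded is_distributional_derivative_iff, THEN conjunct2, THEN conjunct2,
              THEN conjunct2, rule_format, OF t]
            D'[unfolded is_distributional_derivative_iff, THEN conjunct2, THEN conjunct2,
              THEN conjunct2, rule_format, OF t]
          by simp
        then show ?thesis
          by (simp add: P.integral_extend_by_0 N.integral_extend_by_0
              P'.integral_extend_by_0 N'.integral_extend_by_0)
      qed
    qed
    then show ?thesis
      using E by (simp add: P.measure_extend_by_0 N.measure_extend_by_0
          P'.measure_extend_by_0 N'.measure_extend_by_0 Int_absorb2)
  qed
  have eq: "measure P E = measure P' E" if "E \<in> sets borel" "E \<subseteq> {a<..<b}" for E
  proof (rule antisym)
    show "measure P E \<le> measure P' E"
      using D D' by (intro Jordan_positive_part_le[OF _ _ _ _ sum that]) (simp_all add: is_distributional_derivative_iff)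
    show "measure P' E \<le> measure P E"
      using D D' by (intro Jordan_positive_part_le[OF _ _ _ _ sum[symmetric] that]) (simp_all add: is_distributional_derivative_iff)
  qed
  show "P = P'"
    using eq P.sets_eq P'.sets_eq
    by (intro measure_eqI) (simp_all add: P.emeasure_eq_measure P'.emeasure_eq_measure
        sets_restrict_space_iff)
  show "N = N'"
    using eq sum N.sets_eq N'.sets_eq
    by (intro measure_eqI) (simp_all add: N.emeasure_eq_measure N'.emeasure_eq_measure
        sets_restrict_space_iff)
qed

lemma Df_eqI: "is_distributional_derivative a b f D \<Longrightarrow> Df a b f = D"
  unfolding Df_def using is_distributional_derivative_unique
  by (intro the_equality) (metis prod.collapse)+

section \<open>Vanishing distributional derivatives\<close>

lemma integrable_times_bump:
  assumes h: "integrable lborel h"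
  shows "integrable lborel (\<lambda>x. h x * bump n c d x)"
  using borel_measurable_integrable[OF h]
  by (intro Bochner_Integration.integrable_bound[OF h])
    (auto simp: abs_mult bump_bounds mult_left_le)

text \<open>The positive and the negative part of \<open>h\<close> are densities of two finite measures that bump
  functions cannot tell apart.\<close>
lemma AE_eq_0_if_bump_integrals_eq_0:
  fixes h :: "real \<Rightarrow> real"
  assumes h: "integrable lborel h" and supp: "\<And>x. x \<notin> {a<..<b} \<Longrightarrow> h x = 0"
    and int: "\<And>n c d. a \<le> c \<Longrightarrow> d \<le> b \<Longrightarrow> (LINT x|lborel. h x * bump n c d x) = 0"
  shows "AE x in lborel. h x = 0"
proof (rule sigma_finite_measure.density_zero[OF lborel.sigma_finite_measure_axioms h])
  define A where "A = (\<lambda>s::real. density lborel (\<lambda>x. ennreal (max 0 (s * h x))))"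
  note [measurable] = borel_measurable_integrable[OF h]
  have i: "integrable lborel (\<lambda>x. max 0 (s * h x))" for s
    using h by auto
  have sets: "sets (A s) = sets borel" for s by (simp add: A_def)
  have int_A: "(LINT x|A s. f x) = (LINT x|lborel. max 0 (s * h x) * f x)"
    if "f \<in> borel_measurable borel" for s and f :: "real \<Rightarrow> real"
    unfolding A_def using that by (subst integral_density) auto
  have fin: "finite_measure (A s)" for s
  proof (rule finite_measureI)
    show "emeasure (A s) (space (A s)) \<noteq> \<infinity>"
      using i[of s] unfolding A_def
      by (subst emeasure_density) (auto simp: nn_integral_eq_integral)
  qed
  have meas: "measure (A s) S = (LINT x|lborel. max 0 (s * h x) * indicator S x)"
    if "S \<in> sets borel" for s S
    using int_A[of "indicator S" s] that by (simp add: A_def)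
  have null: "measure (A s) (- {a<..<b}) = 0" for s
  proof -
    have zero: "max 0 (s * h x) * indicator (- {a<..<b}) x = 0" for x
      using supp[of x] by (cases "x \<in> {a<..<b}") auto
    have "measure (A s) (- {a<..<b}) = (LINT x|lborel. max 0 (s * h x) * indicator (- {a<..<b}) x)"
      by (rule meas) auto
    then show ?thesis by (simp only: zero Bochner_Integration.integral_zero)
  qed
  have diff: "max 0 (1 * h x) = h x + max 0 (- 1 * h x)" for x by auto
  fix S :: "real set" assume "S \<in> sets lborel"
  then have S: "S \<in> sets borel" by simp
  have "measure (A 1) S + measure (A (-1)) S = measure (A (-1)) S + measure (A (-1)) S"
  proof (rule measures_agree_if_bump_integrals_agree[OF _ _ S])
    fix n c d assume cd: "a \<le> c" "d \<le> b"
    have "(LINT x|A 1. bump n c d x) =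
        (LINT x|lborel. h x * bump n c d x + max 0 (- 1 * h x) * bump n c d x)"
      by (subst int_A) (auto simp only: diff distrib_right bump_measurable)
    also have "\<dots> = (LINT x|lborel. h x * bump n c d x) + (LINT x|A (-1). bump n c d x)"
      by (subst int_A, simp, rule Bochner_Integration.integral_add)
        (rule integrable_times_bump h i[of "-1"])+
    finally show "(LINT x|A 1. bump n c d x) + (LINT x|A (-1). bump n c d x) =
        (LINT x|A (-1). bump n c d x) + (LINT x|A (-1). bump n c d x)"
      using int[OF cd] by simp
  qed (use fin sets null in auto)
  then have "(LINT x|lborel. max 0 (1 * h x) * indicator S x) =
      (LINT x|lborel. max 0 (- 1 * h x) * indicator S x)"
    using S by (simp only: meas)
  moreover have "(LINT x|lborel. max 0 (1 * h x) * indicator S x) =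
      (LINT x|lborel. h x * indicator S x + max 0 (- 1 * h x) * indicator S x)"
    by (simp only: diff distrib_right)
  moreover have "\<dots> = (LINT x|lborel. h x * indicator S x) +
      (LINT x|lborel. max 0 (- 1 * h x) * indicator S x)"
    using S by (intro Bochner_Integration.integral_add integrable_real_mult_indicator h i) auto
  ultimately show "set_lebesgue_integral lborel S h = 0"
    by (simp add: set_lebesgue_integral_def mult.commute)
qed

text \<open>A function is the derivative of a test function exactly when it is smooth, compactly
  supported and has integral zero; this provides the primitive.\<close>
lemma ex_compactly_supported_primitive:
  fixes w :: "real \<Rightarrow> real"
  assumes cont: "continuous_on UNIV w" and supp: "\<And>x. x \<notin> {l..r} \<Longrightarrow> w x = 0"
    and int: "(LINT x|lborel. w x) = 0" and "l \<le> r"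
  shows "\<exists>F. (\<forall>x. (F has_real_derivative w x) (at x)) \<and> (\<forall>x. x \<notin> {l..r} \<longrightarrow> F x = 0)"
proof -
  define F where "F x = (LBINT y=l..x. w y)" for x :: real
  have F: "(F has_real_derivative w x) (at x)" for x
  proof -
    have "((\<lambda>u. LBINT y=ereal l..ereal u. w y) has_vector_derivative w x)
        (at x within {min l x - 1..max l x + 1})"
      by (rule interval_integral_FTC2) (auto intro: continuous_on_subset[OF cont])
    moreover have "at x within {min l x - 1..max l x + 1} = at x"
      by (rule at_within_interior) auto
    ultimately show ?thesis
      unfolding F_def[abs_def] has_real_derivative_iff_has_vector_derivative by argo
  qed
  have left: "F x = F l" if "x < l" for x
  proof -
    have "\<exists>z>x. z < l \<and> F l - F x = (l - x) * w z"
      by (rule MVT2[OF that]) (use F in auto)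
    then show ?thesis using supp by force
  qed
  have right: "F x = F r" if "r < x" for x
  proof -
    have "\<exists>z>r. z < x \<and> F x - F r = (x - r) * w z"
      by (rule MVT2[OF that]) (use F in auto)
    then show ?thesis using supp by force
  qed
  have "F l = 0" by (simp add: F_def)
  moreover have "F r = 0"
  proof -
    have "F r = (LINT x|lborel. indicator {l..r} x *\<^sub>R w x)"
      using \<open>l \<le> r\<close> by (simp add: F_def interval_integral_Icc set_lebesgue_integral_def)
    also have "\<dots> = (LINT x|lborel. w x)"
      using supp by (intro Bochner_Integration.integral_cong) (auto simp: indicator_def)
    finally show ?thesis using int by simp
  qed
  ultimately show ?thesis
    using F left right by (intro exI[of _ F]) (auto simp: not_le)
qed

lemma integrable_bump: "integrable lborel (bump n c d)"
proof (rule Bochner_Integration.integrable_bound)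
  show "integrable lborel (indicator {c..d} :: real \<Rightarrow> real)"
    by (simp add: integrable_indicator_iff emeasure_lborel_Icc_eq)
  show "AE x in lborel. norm (bump n c d x) \<le> norm (indicator {c..d} x :: real)"
    using bump_bounds[of n c d] bump_eq_0'[of _ c d n]
    by (intro AE_I2) (auto simp: indicator_def)
qed simp

text \<open>A distribution that annihilates all derivatives of test functions is constant. Subtracting
  from a bump \<open>\<psi>\<close> the multiple of a fixed bump \<open>\<theta>\<close> with the same integral gives the derivative
  of a test function; hence \<open>\<integral> h \<psi> = C \<integral> \<psi>\<close>, where \<open>C = \<integral> h \<theta> / \<integral> \<theta>\<close> does not
  depend on \<open>\<psi>\<close>, and \<open>h - C\<close> vanishes against all bumps.\<close>
lemma du_Bois_Reymond:
  assumes "a < b" and h: "set_integrable lborel {a<..<b} h"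
    and weak: "\<And>\<phi>. test_function_on {a<..<b} \<phi> \<Longrightarrow>
      (LINT x:{a<..<b}|lborel. h x * deriv \<phi> x) = 0"
  shows "\<exists>C. AE x in lborel. x \<in> {a<..<b} \<longrightarrow> h x = C"
proof -
  define H where "H x = indicator {a<..<b} x * h x" for x
  have H: "integrable lborel H"
    using h by (simp add: set_integrable_def H_def[abs_def])
  have "(\<lambda>n. LINT x|lborel. bump n a b x) \<longlonglongrightarrow> measure lborel {a<..<b}"
    using \<open>a < b\<close> by (intro integral_bump_tendsto) auto
  then have "\<forall>\<^sub>F n in sequentially. 0 < (LINT x|lborel. bump n a b x)"
    by (rule order_tendstoD) (use \<open>a < b\<close> in simp)
  then obtain m where m: "0 < (LINT x|lborel. bump m a b x)"
    by (auto dest: eventually_happens)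
  define T where "T = (LINT x|lborel. bump m a b x)"
  define C where "C = (LINT x|lborel. H x * bump m a b x) / T"
  have C: "(LINT x|lborel. H x * bump n c d x) = C * (LINT x|lborel. bump n c d x)"
    if cd: "a \<le> c" "d \<le> b" for n c d
  proof -
    define r where "r = (LINT x|lborel. bump n c d x) / T"
    define w where "w x = bump n c d x + (- r) * bump m a b x" for x
    have w: "w \<in> flat_algebra"
      unfolding w_def by (intro flat_algebra.intros bump_in_flat_algebra)
    have w_int: "(LINT x|lborel. w x) = 0"
      using m unfolding w_def
      by (subst Bochner_Integration.integral_add)
        (auto intro!: integrable_bump integrable_mult_right simp: r_def T_def)
    \<comment> \<open>The supports of both bumps lie in \<open>[a + e, b - e]\<close>; the bound \<open>(b - a) / 2\<close> keeps it nonempty.\<close>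
    define e where "e = min (1 / real (Suc n)) (min (1 / real (Suc m)) ((b - a) / 2))"
    have "0 < e" and e: "e \<le> 1 / real (Suc n)" "e \<le> 1 / real (Suc m)" "e \<le> (b - a) / 2"
      using \<open>a < b\<close> unfolding e_def by (simp, intro min.cobounded1 min.coboundedI2 min.cobounded2 order_refl)+
    define l where "l = a + e"
    define l' where "l' = b - e"
    have l: "a < l" "l' < b" "l \<le> l'"
      using \<open>0 < e\<close> e(3) by (auto simp: l_def l'_def)
    have w_supp: "w x = 0" if "x \<notin> {l..l'}" for x
    proof -
      have "bump n c d x = 0"
        using that cd e unfolding l_def l'_def by (intro bump_eq_0) auto
      moreover have "bump m a b x = 0"
        using that cd e unfolding l_def l'_def by (intro bump_eq_0) auto
      ultimately show ?thesis by (simp add: w_def)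
    qed
    obtain F where F: "\<And>x. (F has_real_derivative w x) (at x)" "\<And>x. x \<notin> {l..l'} \<Longrightarrow> F x = 0"
      using ex_compactly_supported_primitive[OF flat_algebra_continuous[OF w] w_supp w_int l(3)]
      by blast
    have dF: "deriv F = w"
      using F(1) by (auto intro!: DERIV_imp_deriv)
    have "(deriv ^^ k) F differentiable at x" for k x
    proof (cases k)
      case 0
      then show ?thesis using F(1) real_differentiable_def by auto
    next
      case (Suc j)
      then show ?thesis
        using flat_algebra_differentiable[OF w, of j] dF by (simp add: funpow_Suc_right del: funpow.simps)
    qed
    then have "test_function_on {a<..<b} F"
      using F(2) l(1,2) by (intro test_function_onI[of F l l']) auto
    from weak[OF this] have "(LINT x|lborel. H x * w x) = 0"
      by (simp add: dF set_lebesgue_integral_def H_def mult.assoc)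
    also have "(\<lambda>x. H x * w x) = (\<lambda>x. H x * bump n c d x + (- r) * (H x * bump m a b x))"
      by (auto simp: w_def algebra_simps)
    finally have "(LINT x|lborel. H x * bump n c d x) + (- r) * (LINT x|lborel. H x * bump m a b x) = 0"
      by (subst (asm) Bochner_Integration.integral_add)
        (auto intro!: integrable_times_bump H integrable_mult_right)
    then show ?thesis using m by (simp add: C_def r_def T_def field_simps)
  qed
  have I: "integrable lborel (\<lambda>x. C * indicator {a<..<b} x)"
    using \<open>a < b\<close> by (intro integrable_mult_right) (simp add: integrable_indicator_iff)
  have "AE x in lborel. H x - C * indicator {a<..<b} x = 0"
  proof (rule AE_eq_0_if_bump_integrals_eq_0[of _ a b])
    show "integrable lborel (\<lambda>x. H x - C * indicator {a<..<b} x)"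
      using H I by (rule Bochner_Integration.integrable_diff)
    fix n c d assume cd: "a \<le> c" "d \<le> b"
    have "(C * indicator {a<..<b} x) * bump n c d x = C * bump n c d x" for x
    proof (cases "x \<in> {c<..<d}")
      case True
      then show ?thesis using cd by simp
    next
      case False
      then show ?thesis by (simp add: bump_eq_0')
    qed
    then have "(LINT x|lborel. (H x - C * indicator {a<..<b} x) * bump n c d x) =
        (LINT x|lborel. H x * bump n c d x - C * bump n c d x)"
      by (simp only: left_diff_distrib)
    also have "\<dots> = 0"
      using C[OF cd, of n]
      by (subst Bochner_Integration.integral_diff)
        (auto intro!: integrable_times_bump H integrable_mult_right integrable_bump)
    finally show "(LINT x|lborel. (H x - C * indicator {a<..<b} x) * bump n c d x) = 0" .
  qed (auto simp: H_def)
  then show ?thesis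
    by (intro exI[of _ C]) (auto simp: H_def elim: eventually_mono)
qed

section \<open>Functions of bounded variation as differences of distribution functions\<close>

text \<open>Integration by parts: the distributional derivative of the distribution function of \<open>M\<close> is
  \<open>M\<close> itself. Write the distribution function as an integral over \<open>M\<close> and swap by Fubini;
  the inner integral of \<open>\<phi>'\<close> over \<open>[y, \<infinity>)\<close> is \<open>- \<phi> y\<close>.\<close>
lemma integral_deriv_times_cdf:
  fixes \<phi> \<phi>' :: "real \<Rightarrow> real"
  assumes M: "finite_measure M" "sets M = sets borel"
    and \<phi>: "\<And>x. (\<phi> has_real_derivative \<phi>' x) (at x)" and cont: "\<And>x. isCont \<phi>' x"
    and supp: "\<And>x. x \<notin> {l..r} \<Longrightarrow> \<phi> x = 0" "\<And>x. x \<notin> {l..r} \<Longrightarrow> \<phi>' x = 0"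
  shows "(LINT x|lborel. \<phi>' x * cdf M x) = - (LINT x|M. \<phi> x)"
proof -
  interpret finite_measure M by fact
  interpret pair_sigma_finite lborel M ..
  have [measurable_cong]: "sets M = sets borel" by fact
  have space: "space M = UNIV" using sets_eq_imp_space_eq[OF M(2)] by simp
  have [measurable]: "\<phi>' \<in> borel_measurable borel"
    using cont by (intro borel_measurable_continuous_onI continuous_at_imp_continuous_on) auto
  let ?f = "\<lambda>x y. if y \<le> x then \<phi>' x else 0"
  have inner: "(LINT y|M. ?f x y) = \<phi>' x * cdf M x" for x
  proof -
    have "(LINT y|M. ?f x y) = (LINT y|M. \<phi>' x * indicator {..x} y)"
      by (intro Bochner_Integration.integral_cong) (auto simp: indicator_def)
    then show ?thesis by (simp add: cdf_def space)
  qed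
  have int\<phi>': "integrable lborel \<phi>'"
  proof -
    have "set_integrable lborel {l..r} \<phi>'"
      using cont by (intro borel_integrable_atLeastAtMost') (auto intro!: continuous_at_imp_continuous_on)
    moreover have "(\<lambda>x. indicator {l..r} x *\<^sub>R \<phi>' x) = \<phi>'"
      using supp(2) by (auto simp: indicator_def fun_eq_iff simp del: atLeastAtMost_iff)
    ultimately show ?thesis by (simp add: set_integrable_def)
  qed
  have int: "integrable (lborel \<Otimes>\<^sub>M M) (\<lambda>(x, y). ?f x y)"
  proof (rule Fubini_integrable)
    show "AE x in lborel. integrable M (\<lambda>y. case (x, y) of (x, y) \<Rightarrow> ?f x y)"
      by (intro AE_I2 integrable_const_bound[of _ "\<bar>\<phi>' _\<bar>"]) auto
    have "(LINT y|M. norm (?f x y)) = \<bar>\<phi>' x\<bar> * cdf M x" for x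
    proof -
      have "(LINT y|M. norm (?f x y)) = (LINT y|M. \<bar>\<phi>' x\<bar> * indicator {..x} y)"
        by (intro Bochner_Integration.integral_cong) (auto simp: indicator_def)
      then show ?thesis by (simp add: cdf_def space)
    qed
    moreover have "integrable lborel (\<lambda>x. \<bar>\<phi>' x\<bar> * cdf M x)"
    proof (rule Bochner_Integration.integrable_bound)
      show "integrable lborel (\<lambda>x. measure M UNIV * \<phi>' x)"
        using int\<phi>' by simp
      have "cdf M \<in> borel_measurable borel"
        by (intro borel_measurable_mono monoI) (auto simp: cdf_def M(2) intro!: finite_measure_mono)
      then show "(\<lambda>x. \<bar>\<phi>' x\<bar> * cdf M x) \<in> borel_measurable lborel"
        by simp
      show "AE x in lborel. norm (\<bar>\<phi>' x\<bar> * cdf M x) \<le> norm (measure M UNIV * \<phi>' x)"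
        using bounded_measure
        by (intro AE_I2) (auto simp: cdf_def abs_mult space mult.commute intro!: mult_left_mono)
    qed
    ultimately show "integrable lborel (\<lambda>x. LINT y|M. norm (case (x, y) of (x, y) \<Rightarrow> ?f x y))"
      by simp
  qed measurable
  have "(LINT x|lborel. \<phi>' x * cdf M x) = (LINT x|lborel. LINT y|M. ?f x y)"
    by (simp add: inner)
  also have "\<dots> = (LINT y|M. LINT x|lborel. ?f x y)"
    using Fubini_integral[OF int] by simp
  also have "\<dots> = (LINT y|M. - \<phi> y)"
  proof (intro Bochner_Integration.integral_cong refl)
    fix y
    define R where "R = max r y + 1"
    have "(LINT x|lborel. ?f x y) = (LINT x|lborel. \<phi>' x * indicator {y..R} x)"
    proof (intro Bochner_Integration.integral_cong refl)
      fix x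
      show "?f x y = \<phi>' x * indicator {y..R} x"
        using supp(2)[of x] by (cases "x \<le> r") (auto simp: indicator_def R_def)
    qed
    also have "\<dots> = \<phi> R - \<phi> y"
      using \<phi> cont by (intro integral_FTC_Icc_real) (auto simp: R_def)
    also have "\<phi> R = 0" by (rule supp) (auto simp: R_def)
    finally show "(LINT x|lborel. ?f x y) = - \<phi> y" by simp
  qed
  finally show ?thesis by simp
qed

lemma test_functionD:
  assumes "test_function_on {a<..<b} \<phi>"
  shows "(\<phi> has_real_derivative deriv \<phi> x) (at x)" "isCont (deriv \<phi>) x"
    "x \<notin> {a<..<b} \<Longrightarrow> \<phi> x = 0" "x \<notin> {a<..<b} \<Longrightarrow> deriv \<phi> x = 0"
proof -
  have diff: "(deriv ^^ n) \<phi> differentiable at x" for n x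
    using assms by (simp add: test_function_on_def)
  show D: "(\<phi> has_real_derivative deriv \<phi> x) (at x)" for x
    using diff[of 0 x] by (simp add: DERIV_deriv_iff_real_differentiable)
  show "isCont (deriv \<phi>) x"
    using diff[of 1 x] by (simp add: differentiable_imp_continuous_within)
  let ?K = "closure {x. \<phi> x \<noteq> 0}"
  have K: "?K \<subseteq> {a<..<b}" using assms by (simp add: test_function_on_def)
  show "\<phi> x = 0" if "x \<notin> {a<..<b}"
    using K closure_subset[of "{x. \<phi> x \<noteq> 0}"] that by fast
  show "deriv \<phi> x = 0" if "x \<notin> {a<..<b}"
  proof -
    have "((\<lambda>_. 0) has_real_derivative 0) (at x)" by simp
    then have "(\<phi> has_real_derivative 0) (at x)"
    proof (rule has_field_derivative_transform_within_open)
      show "open (- ?K)" by auto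
      show "x \<in> - ?K" using K that by blast
      show "0 = \<phi> y" if "y \<in> - ?K" for y
        using that closure_subset[of "{x. \<phi> x \<noteq> 0}"] by auto
    qed
    then show ?thesis by (rule DERIV_imp_deriv)
  qed
qed

lemma set_integrable_times_bounded:
  fixes f g :: "real \<Rightarrow> real"
  assumes f: "set_integrable lborel S f" and g: "g \<in> borel_measurable borel" "\<And>x. \<bar>g x\<bar> \<le> B"
  shows "set_integrable lborel S (\<lambda>x. f x * g x)"
  unfolding set_integrable_def
proof (rule Bochner_Integration.integrable_bound)
  show "integrable lborel (\<lambda>x. B * (indicator S x *\<^sub>R f x))"
    using f unfolding set_integrable_def by (intro integrable_mult_right)
  have "(\<lambda>x. (indicator S x *\<^sub>R f x) * g x) \<in> borel_measurable lborel"
    using borel_measurable_integrable[OF f[unfolded set_integrable_def]] g(1)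
    by (intro borel_measurable_times) auto
  then show "(\<lambda>x. indicator S x *\<^sub>R (f x * g x)) \<in> borel_measurable lborel"
    by (simp add: mult.assoc)
  have "0 \<le> B" using g(2)[of 0] by linarith
  have "\<bar>f x\<bar> * \<bar>g x\<bar> \<le> \<bar>B\<bar> * \<bar>f x\<bar>" for x
    using g(2)[of x] \<open>0 \<le> B\<close> by (subst mult.commute) (intro mult_right_mono, auto)
  then show "AE x in lborel. norm (indicator S x *\<^sub>R (f x * g x)) \<le>
      norm (B * (indicator S x *\<^sub>R f x))"
    by (intro AE_I2) (auto simp: abs_mult indicator_def)
qed

lemma set_integrable_cdf:
  assumes "finite_measure M" "sets M = sets borel"
  shows "set_integrable lborel {a<..<b} (cdf M)"
proof -
  interpret finite_measure M by fact
  have "cdf M \<in> borel_measurable borel"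
    by (intro borel_measurable_mono monoI)
      (auto simp: cdf_def assms(2) intro!: finite_measure_mono)
  moreover have "\<bar>cdf M x\<bar> \<le> measure M (space M)" for x
    by (simp add: cdf_def bounded_measure)
  moreover have "set_integrable lborel {a<..<b} (\<lambda>_. 1)"
    by (cases "a \<le> b") (auto simp: set_integrable_def integrable_indicator_iff)
  ultimately have "set_integrable lborel {a<..<b} (\<lambda>x. 1 * cdf M x)"
    by (intro set_integrable_times_bounded)
  then show ?thesis by simp
qed

text \<open>Both sides have the same distributional derivative \<open>P - N\<close>, so they differ by a constant.\<close>
lemma BV_representation:
  assumes "a < b" and f: "set_integrable lborel {a<..<b} f"
    and D: "is_distributional_derivative a b f (P, N)"
  shows "\<exists>C. AE x in lborel. x \<in> {a<..<b} \<longrightarrow>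
      f x = C + cdf (extend_by_0 P) x - cdf (extend_by_0 N) x"
proof -
  interpret P: finite_measure_on_interval P a b
    using D by (simp add: is_distributional_derivative_iff)
  interpret N: finite_measure_on_interval N a b
    using D by (simp add: is_distributional_derivative_iff)
  let ?P = "cdf (extend_by_0 P)" and ?N = "cdf (extend_by_0 N)"
  have iP: "set_integrable lborel {a<..<b} ?P"
    by (intro set_integrable_cdf P.finite_measure_extend_by_0 P.sets_extend_by_0)
  have iN: "set_integrable lborel {a<..<b} ?N"
    by (intro set_integrable_cdf N.finite_measure_extend_by_0 N.sets_extend_by_0)
  have "\<exists>C. AE x in lborel. x \<in> {a<..<b} \<longrightarrow> f x - ?P x + ?N x = C"
  proof (rule du_Bois_Reymond[OF \<open>a < b\<close>])
    show "set_integrable lborel {a<..<b} (\<lambda>x. f x - ?P x + ?N x)"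
      by (intro set_integral_add set_integral_diff f iP iN)
    fix \<phi> assume \<phi>: "test_function_on {a<..<b} \<phi>"
    note t = test_functionD[OF \<phi>]
    have cont: "continuous_on S (deriv \<phi>)" for S
      using t(2) by (intro continuous_at_imp_continuous_on) auto
    have meas: "deriv \<phi> \<in> borel_measurable borel"
      by (intro borel_measurable_continuous_onI cont)
    have "bounded (deriv \<phi> ` {a..b})"
      by (intro compact_imp_bounded compact_continuous_image cont) auto
    then obtain B where B0: "\<forall>x\<in>{a..b}. \<bar>deriv \<phi> x\<bar> \<le> B"
      by (auto simp: bounded_iff)
    have B: "\<bar>deriv \<phi> x\<bar> \<le> \<bar>B\<bar>" for x
    proof (cases "x \<in> {a<..<b}")
      case True
      then have "\<bar>deriv \<phi> x\<bar> \<le> B" by (intro B0[rule_format]) auto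
      then show ?thesis by linarith
    next
      case False
      then show ?thesis by (simp add: t(4))
    qed
    note i = set_integrable_times_bounded[OF _ meas B]
    have ibp: "(LINT x:{a<..<b}|lborel. cdf M x * deriv \<phi> x) = - (LINT x|M. \<phi> x)"
      if "finite_measure M" "sets M = sets borel" for M
    proof -
      have "(LINT x:{a<..<b}|lborel. cdf M x * deriv \<phi> x) = (LINT x|lborel. deriv \<phi> x * cdf M x)"
        unfolding set_lebesgue_integral_def
        by (intro Bochner_Integration.integral_cong)
          (auto simp: indicator_def t(4) simp del: greaterThanLessThan_iff)
      also have "\<dots> = - (LINT x|M. \<phi> x)"
        by (rule integral_deriv_times_cdf[OF that t(1,2), of a b]) (auto intro!: t(3,4))
      finally show ?thesis .
    qed
    have \<phi>_meas: "\<phi> \<in> borel_measurable borel"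
      by (intro borel_measurable_continuous_onI continuous_at_imp_continuous_on ballI DERIV_isCont[OF t(1)])
    have "(LINT x:{a<..<b}|lborel. (f x - ?P x + ?N x) * deriv \<phi> x) =
        (LINT x:{a<..<b}|lborel. f x * deriv \<phi> x - ?P x * deriv \<phi> x + ?N x * deriv \<phi> x)"
      by (simp add: algebra_simps)
    also have "\<dots> = (LINT x:{a<..<b}|lborel. f x * deriv \<phi> x) -
        (LINT x:{a<..<b}|lborel. ?P x * deriv \<phi> x) + (LINT x:{a<..<b}|lborel. ?N x * deriv \<phi> x)"
      by (simp only: set_integral_add(2)[OF set_integral_diff(1)[OF i[OF f] i[OF iP]] i[OF iN]]
          set_integral_diff(2)[OF i[OF f] i[OF iP]])
    also have "(LINT x:{a<..<b}|lborel. f x * deriv \<phi> x) = - ((LINT x|P. \<phi> x) - (LINT x|N. \<phi> x))"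
      using D \<phi> by (simp add: is_distributional_derivative_iff)
    finally show "(LINT x:{a<..<b}|lborel. (f x - ?P x + ?N x) * deriv \<phi> x) = 0"
      by (simp add: ibp P.finite_measure_extend_by_0 P.sets_extend_by_0
          N.finite_measure_extend_by_0 N.sets_extend_by_0
          P.integral_extend_by_0 N.integral_extend_by_0 \<phi>_meas)
  qed
  then obtain C where C: "AE x in lborel. x \<in> {a<..<b} \<longrightarrow> f x - ?P x + ?N x = C" by blast
  then show ?thesis
    by (intro exI[of _ C]) (auto elim!: eventually_mono)
qed

text \<open>Together with uniqueness this ties together the derivatives taken on \<open>(\<epsilon>, \<delta>)\<close> for different
  \<open>\<epsilon>\<close>, each of which is a separately chosen pair of measures.\<close>
lemma is_distributional_derivative_restrict:
  assumes D: "is_distributional_derivative a b f (P, N)" and "a \<le> a'"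
  shows "is_distributional_derivative a' b f
      (restrict_space P {a'<..<b}, restrict_space N {a'<..<b})"
proof -
  let ?I = "{a'<..<b}"
  have sub: "?I \<subseteq> {a<..<b}" using \<open>a \<le> a'\<close> by auto
  have fin: "finite_measure_on_interval (restrict_space M ?I) a' b"
    if "finite_measure_on_interval M a b" for M
  proof -
    interpret M: finite_measure_on_interval M a b by fact
    have "finite_measure (restrict_space M ?I)"
      using sub by (intro finite_measure_restrict_space M.finite_measure_axioms)
        (auto simp: M.space_eq M.sets_iff)
    moreover have "S \<in> sets (restrict_space M ?I) \<longleftrightarrow> S \<in> sets (restrict_space borel ?I)" for S
      using sub by (subst (1 2) sets_restrict_space_iff) (auto simp: M.space_eq M.sets_iff)
    ultimately show ?thesis
      by (simp add: finite_measure_on_interval_def finite_measure_on_interval_axioms_def set_eq_iff)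
  qed
  have int: "(LINT x|restrict_space M ?I. \<phi> x) = (LINT x|M. \<phi> x)"
    if "finite_measure_on_interval M a b" "test_function_on ?I \<phi>" for M \<phi>
  proof -
    interpret M: finite_measure_on_interval M a b by fact
    have "(LINT x|restrict_space M ?I. \<phi> x) = (LINT x|M. indicator ?I x *\<^sub>R \<phi> x)"
      using sub by (intro integral_restrict_space) (auto simp: M.space_eq M.sets_iff)
    also have "\<dots> = (LINT x|M. \<phi> x)"
      using test_functionD(3)[OF that(2)]
      by (intro Bochner_Integration.integral_cong refl) (auto simp: indicator_def)
    finally show ?thesis .
  qed
  have fP: "finite_measure_on_interval P a b" and fN: "finite_measure_on_interval N a b"
    and sing: "mutually_singular P N"
    using D by (auto simp: is_distributional_derivative_iff)
  interpret P: finite_measure_on_interval P a b by fact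
  interpret N: finite_measure_on_interval N a b by fact
  have sing': "mutually_singular (restrict_space P ?I) (restrict_space N ?I)"
  proof -
    obtain S where S: "S \<in> sets P" "emeasure P S = 0" "emeasure N ({a<..<b} - S) = 0"
      using sing unfolding mutually_singular_def P.space_eq by blast
    have "emeasure P (S \<inter> ?I) = 0"
      using S by (intro emeasure_eq_0[OF S(1,2)]) auto
    moreover have "emeasure N (?I - S) = 0"
      using S sub by (intro emeasure_eq_0[OF _ S(3)]) (auto simp: P.sets_iff N.sets_iff)
    moreover have "?I - S \<inter> ?I = ?I - S" by auto
    moreover have "?I \<inter> space P \<in> sets P" "?I \<inter> space N \<in> sets N"
      using sub by (auto simp: P.space_eq N.space_eq P.sets_iff N.sets_iff)
    moreover have "?I \<inter> {a<..<b} = ?I" using sub by blast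
    moreover have "S \<inter> ?I \<in> sets P" using S(1) sub by (auto simp: P.sets_iff)
    ultimately show ?thesis
      unfolding mutually_singular_def
      by (intro bexI[of _ "S \<inter> ?I"])
        (simp_all add: emeasure_restrict_space sets_restrict_space_iff space_restrict_space P.space_eq
          del: Int_greaterThanLessThan)
  qed
  have weak: "(LINT x:?I|lborel. f x * deriv \<phi> x) =
      - ((LINT x|restrict_space P ?I. \<phi> x) - (LINT x|restrict_space N ?I. \<phi> x))"
    if t: "test_function_on ?I \<phi>" for \<phi>
  proof -
    have "test_function_on {a<..<b} \<phi>"
      using t sub by (auto simp: test_function_on_def)
    then have "(LINT x:{a<..<b}|lborel. f x * deriv \<phi> x) = - ((LINT x|P. \<phi> x) - (LINT x|N. \<phi> x))"
      using D by (simp add: is_distributional_derivative_iff)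
    moreover have "(LINT x:{a<..<b}|lborel. f x * deriv \<phi> x) = (LINT x:?I|lborel. f x * deriv \<phi> x)"
      unfolding set_lebesgue_integral_def using test_functionD(4)[OF t] sub
      by (intro Bochner_Integration.integral_cong refl) (auto simp: indicator_def)
    ultimately show ?thesis by (simp add: int[OF fP t] int[OF fN t])
  qed
  show ?thesis
    unfolding is_distributional_derivative_iff
    by (intro conjI allI impI fin fP fN sing' weak)
qed

section \<open>Behaviour at the left end point\<close>

lemma tendsto_SUP_at_right_0:
  fixes F :: "real \<Rightarrow> 'a::{complete_linorder, linorder_topology}"
  assumes "0 < \<delta>" and anti: "\<And>x y. 0 < x \<Longrightarrow> x \<le> y \<Longrightarrow> y < \<delta> \<Longrightarrow> F y \<le> F x"
  shows "(F \<longlongrightarrow> (SUP x\<in>{0<..<\<delta>}. F x)) (at_right 0)"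
proof (rule increasing_tendsto)
  show "\<forall>\<^sub>F x in at_right 0. F x \<le> (SUP x\<in>{0<..<\<delta>}. F x)"
    using eventually_at_right_real[OF \<open>0 < \<delta>\<close>]
    by eventually_elim (auto intro: SUP_upper)
next
  fix y assume "y < (SUP x\<in>{0<..<\<delta>}. F x)"
  then obtain z where z: "0 < z" "z < \<delta>" "y < F z"
    by (auto simp: less_SUP_iff)
  show "\<forall>\<^sub>F x in at_right 0. y < F x"
    using eventually_at_right_real[OF z(1)]
    by eventually_elim (use z anti in \<open>force intro: less_le_trans\<close>)
qed

lemma convergent_at_right_0_if_antimono_bounded:
  fixes q :: "real \<Rightarrow> real"
  assumes "0 < \<delta>" and anti: "\<And>x y. 0 < x \<Longrightarrow> x \<le> y \<Longrightarrow> y < \<delta> \<Longrightarrow> q y \<le> q x"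
    and bdd: "\<And>x. 0 < x \<Longrightarrow> x < \<delta> \<Longrightarrow> q x \<le> B"
  shows "\<exists>l. (q \<longlongrightarrow> l) (at_right 0)"
proof (intro exI increasing_tendsto)
  have ne: "{0<..<\<delta>} \<noteq> {}" and bdd: "bdd_above (q ` {0<..<\<delta>})"
    using \<open>0 < \<delta>\<close> bdd by (auto intro: bdd_aboveI2[of _ _ B])
  show "\<forall>\<^sub>F x in at_right 0. q x \<le> (SUP x\<in>{0<..<\<delta>}. q x)"
    using eventually_at_right_real[OF \<open>0 < \<delta>\<close>]
    by eventually_elim (auto intro: cSUP_upper bdd)
  fix y assume "y < (SUP x\<in>{0<..<\<delta>}. q x)"
  then obtain z where z: "0 < z" "z < \<delta>" "y < q z"
    using less_cSUP_iff[OF ne bdd] by auto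
  show "\<forall>\<^sub>F x in at_right 0. y < q x"
    using eventually_at_right_real[OF z(1)]
    by eventually_elim (use z anti in \<open>force intro: less_le_trans\<close>)
qed

lemma SUP_ennreal_less_top_iff:
  fixes q :: "'a \<Rightarrow> real"
  shows "(SUP x\<in>S. ennreal (q x)) < \<infinity> \<longleftrightarrow> (\<exists>B. \<forall>x\<in>S. q x \<le> B)"
proof
  assume "(SUP x\<in>S. ennreal (q x)) < \<infinity>"
  then obtain B where B: "0 \<le> B" "(SUP x\<in>S. ennreal (q x)) = ennreal B"
    by (auto simp: less_top_ennreal)
  have "q x \<le> B" if "x \<in> S" for x
  proof -
    have "ennreal (q x) \<le> ennreal B"
      unfolding B(2)[symmetric] using that by (rule SUP_upper)
    then show ?thesis using B(1) by (simp add: ennreal_le_iff)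
  qed
  then show "\<exists>B. \<forall>x\<in>S. q x \<le> B" by blast
next
  assume "\<exists>B. \<forall>x\<in>S. q x \<le> B"
  then obtain B where "\<forall>x\<in>S. q x \<le> B" by blast
  then have "(SUP x\<in>S. ennreal (q x)) \<le> ennreal B"
    by (intro SUP_least ennreal_leI) auto
  then show "(SUP x\<in>S. ennreal (q x)) < \<infinity>"
    using le_less_trans by fastforce
qed

locale BV_away_from_0 =
  fixes k :: "real \<Rightarrow> real" and \<delta> :: real
  assumes \<delta>_pos: "0 < \<delta>" and BV: "\<And>\<epsilon>. 0 < \<epsilon> \<Longrightarrow> \<epsilon> < \<delta> \<Longrightarrow> k \<in> BV \<epsilon> \<delta>"
begin

text \<open>Mass of the positive and of the negative part of the derivative on \<open>(x, \<delta>)\<close>. Measuring from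
  the right end point \<open>\<delta>\<close> keeps both finite and makes the limit at \<open>0\<close> a monotone one.\<close>
definition rise :: "real \<Rightarrow> real" where
  "rise x = measure (Df_pos x \<delta> k) {x<..<\<delta>}"

definition fall :: "real \<Rightarrow> real" where
  "fall x = measure (Df_neg x \<delta> k) {x<..<\<delta>}"

context
  fixes \<epsilon> :: real
  assumes \<epsilon>: "0 < \<epsilon>" "\<epsilon> < \<delta>"
begin

lemma derivative: "is_distributional_derivative \<epsilon> \<delta> k (Df_pos \<epsilon> \<delta> k, Df_neg \<epsilon> \<delta> k)"
  using BV[OF \<epsilon>] Df_eqI[of \<epsilon> \<delta> k] by (auto simp: BV_def)

interpretation P: finite_measure_on_interval "Df_pos \<epsilon> \<delta> k" \<epsilon> \<delta>
  using derivative by (simp only: is_distributional_derivative_iff)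

interpretation N: finite_measure_on_interval "Df_neg \<epsilon> \<delta> k" \<epsilon> \<delta>
  using derivative by (simp only: is_distributional_derivative_iff)

lemma Df_pos_norm_eq: "Df_pos_norm \<epsilon> \<delta> k = ennreal (rise \<epsilon>)"
  by (simp add: Df_pos_norm_def rise_def P.emeasure_eq_measure)

lemma BV_norm_eq: "BV_norm \<epsilon> \<delta> k = ennreal (rise \<epsilon> + fall \<epsilon>)"
  by (simp add: BV_norm_def rise_def fall_def P.emeasure_eq_measure N.emeasure_eq_measure)

lemma rise_fall_eq:
  assumes "\<epsilon> \<le> x" "x < \<delta>"
  shows "rise x = measure (Df_pos \<epsilon> \<delta> k) {x<..<\<delta>}" "fall x = measure (Df_neg \<epsilon> \<delta> k) {x<..<\<delta>}"
proof -
  have eq: "Df x \<delta> k = (restrict_space (Df_pos \<epsilon> \<delta> k) {x<..<\<delta>}, restrict_space (Df_neg \<epsilon> \<delta> k) {x<..<\<delta>})"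
    using is_distributional_derivative_restrict[OF derivative \<open>\<epsilon> \<le> x\<close>] by (rule Df_eqI)
  have "{x<..<\<delta>} \<subseteq> {\<epsilon><..<\<delta>}" using assms by auto
  then show "rise x = measure (Df_pos \<epsilon> \<delta> k) {x<..<\<delta>}" "fall x = measure (Df_neg \<epsilon> \<delta> k) {x<..<\<delta>}"
    unfolding rise_def fall_def eq fst_conv snd_conv
    by (auto intro!: measure_restrict_space simp: P.space_eq N.space_eq P.sets_iff N.sets_iff)
qed

lemma rise_fall_eq_cdf:
  assumes "\<epsilon> \<le> x" "x < \<delta>"
  shows "rise x = measure (extend_by_0 (Df_pos \<epsilon> \<delta> k)) UNIV - cdf (extend_by_0 (Df_pos \<epsilon> \<delta> k)) x"
    and "fall x = measure (extend_by_0 (Df_neg \<epsilon> \<delta> k)) UNIV - cdf (extend_by_0 (Df_neg \<epsilon> \<delta> k)) x"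
proof -
  have "{\<epsilon><..<\<delta>} - {..x} \<inter> {\<epsilon><..<\<delta>} = {x<..<\<delta>}" using assms by auto
  then show "rise x = measure (extend_by_0 (Df_pos \<epsilon> \<delta> k)) UNIV - cdf (extend_by_0 (Df_pos \<epsilon> \<delta> k)) x"
    and "fall x = measure (extend_by_0 (Df_neg \<epsilon> \<delta> k)) UNIV - cdf (extend_by_0 (Df_neg \<epsilon> \<delta> k)) x"
    using P.finite_measure_Diff[of "{\<epsilon><..<\<delta>}" "{..x} \<inter> {\<epsilon><..<\<delta>}"]
      N.finite_measure_Diff[of "{\<epsilon><..<\<delta>}" "{..x} \<inter> {\<epsilon><..<\<delta>}"]
    by (auto simp: rise_fall_eq[OF assms] cdf_def P.measure_extend_by_0 N.measure_extend_by_0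
        P.sets_iff N.sets_iff)
qed

lemma rise_fall_antimono:
  assumes "\<epsilon> \<le> y" "y < \<delta>"
  shows "rise y \<le> rise \<epsilon>" "fall y \<le> fall \<epsilon>"
proof -
  have "{y<..<\<delta>} \<subseteq> {\<epsilon><..<\<delta>}" using assms by auto
  then show "rise y \<le> rise \<epsilon>" "fall y \<le> fall \<epsilon>"
    unfolding rise_fall_eq[OF assms] rise_fall_eq[OF order_refl \<epsilon>(2)]
    by (intro P.finite_measure_mono N.finite_measure_mono; simp add: P.sets_iff N.sets_iff)+
qed

lemma continuous_rise_fall:
  assumes "\<epsilon> < x" "x < \<delta>"
  shows "continuous (at_right x) rise" "continuous (at_right x) fall"
proof -
  have *: "continuous (at_right x) q"
    if M: "finite_measure_on_interval M \<epsilon> \<delta>"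
      and q: "\<And>y. \<epsilon> \<le> y \<Longrightarrow> y < \<delta> \<Longrightarrow>
        q y = measure (extend_by_0 M) UNIV - cdf (extend_by_0 M) y" for M q
  proof -
    interpret M: finite_measure_on_interval M \<epsilon> \<delta> by fact
    interpret E: finite_borel_measure "extend_by_0 M"
      using M.finite_measure_extend_by_0 M.sets_extend_by_0
      by (simp add: finite_borel_measure_def finite_borel_measure_axioms_def)
    have "((\<lambda>y. measure (extend_by_0 M) UNIV - cdf (extend_by_0 M) y) \<longlongrightarrow>
        measure (extend_by_0 M) UNIV - cdf (extend_by_0 M) x) (at_right x)"
      using E.cdf_is_right_cont[of x] by (intro tendsto_diff tendsto_const) (simp add: continuous_within)
    moreover have "\<forall>\<^sub>F y in at_right x. measure (extend_by_0 M) UNIV - cdf (extend_by_0 M) y = q y"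
      using eventually_at_right_real[OF assms(2)] by eventually_elim (use assms q in auto)
    ultimately show ?thesis
      using assms q by (auto simp: continuous_within elim: Lim_transform_eventually)
  qed
  show "continuous (at_right x) rise"
    by (rule * [OF P.finite_measure_on_interval_axioms rise_fall_eq_cdf(1)])
  show "continuous (at_right x) fall"
    by (rule * [OF N.finite_measure_on_interval_axioms rise_fall_eq_cdf(2)])
qed

text \<open>Here the constant may still depend on \<open>\<epsilon>\<close>.\<close>
lemma representation_on_subinterval:
  "\<exists>C. AE x in lborel. x \<in> {\<epsilon><..<\<delta>} \<longrightarrow> k x = C - rise x + fall x"
proof -
  have "set_integrable lborel {\<epsilon>..\<delta>} k"
    using BV[OF \<epsilon>] by (auto simp: BV_def locally_integrable_on_def)
  then have "set_integrable lborel {\<epsilon><..<\<delta>} k"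
    by (rule set_integrable_subset) auto
  from BV_representation[OF \<epsilon>(2) this derivative]
  obtain C where C: "AE x in lborel. x \<in> {\<epsilon><..<\<delta>} \<longrightarrow>
      k x = C + cdf (extend_by_0 (Df_pos \<epsilon> \<delta> k)) x - cdf (extend_by_0 (Df_neg \<epsilon> \<delta> k)) x" by blast
  show ?thesis
    by (rule exI[of _ "C + measure (extend_by_0 (Df_pos \<epsilon> \<delta> k)) UNIV -
          measure (extend_by_0 (Df_neg \<epsilon> \<delta> k)) UNIV"], rule eventually_mono[OF C])
      (auto simp: rise_fall_eq_cdf)
qed

end

lemma rise_nonneg: "0 \<le> rise x" and fall_nonneg: "0 \<le> fall x"
  by (simp_all add: rise_def fall_def)

text \<open>The constants belonging to two values of \<open>\<epsilon>\<close> agree because both formulas hold almost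
  everywhere on a common interval. Countably many values of \<open>\<epsilon>\<close> exhaust \<open>(0, \<delta>)\<close>.\<close>
lemma representation: "\<exists>C. AE x in lborel. x \<in> {0<..<\<delta>} \<longrightarrow> k x = C - rise x + fall x"
proof -
  have "\<forall>\<epsilon>\<in>{0<..<\<delta>}. \<exists>C. AE x in lborel. x \<in> {\<epsilon><..<\<delta>} \<longrightarrow> k x = C - rise x + fall x"
    using representation_on_subinterval by auto
  then obtain C where C: "\<And>\<epsilon>. 0 < \<epsilon> \<Longrightarrow> \<epsilon> < \<delta> \<Longrightarrow>
      AE x in lborel. x \<in> {\<epsilon><..<\<delta>} \<longrightarrow> k x = C \<epsilon> - rise x + fall x"
    unfolding bchoice_iff by (metis greaterThanLessThan_iff)
  have C_eq: "C \<epsilon> = C (\<delta> / 2)" if \<epsilon>: "0 < \<epsilon>" "\<epsilon> < \<delta>" for \<epsilon>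
  proof (rule ccontr)
    assume ne: "C \<epsilon> \<noteq> C (\<delta> / 2)"
    let ?m = "max \<epsilon> (\<delta> / 2)"
    have "AE x in lborel. x \<notin> {?m<..<\<delta>}"
      using C[OF \<epsilon>] C[of "\<delta> / 2"] \<delta>_pos ne by (auto elim: eventually_elim2)
    then have "{?m<..<\<delta>} \<in> null_sets lborel"
      by (subst AE_iff_null_sets) auto
    then show False using \<epsilon> \<delta>_pos by (simp add: null_sets_def emeasure_lborel_Ioo)
  qed
  have "AE x in lborel. \<forall>n. x \<in> {\<delta> / real (n + 2)<..<\<delta>} \<longrightarrow> k x = C (\<delta> / 2) - rise x + fall x"
    unfolding AE_all_countable
  proof
    fix n
    have "0 < \<delta> / real (n + 2)" "\<delta> / real (n + 2) < \<delta>"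
      using \<delta>_pos by (auto simp: field_simps add_pos_nonneg)
    then show "AE x in lborel. x \<in> {\<delta> / real (n + 2)<..<\<delta>} \<longrightarrow> k x = C (\<delta> / 2) - rise x + fall x"
      using C C_eq by metis
  qed
  moreover have "\<exists>n. \<delta> / real (n + 2) < x" if "0 < x" for x
  proof -
    obtain n where "\<delta> / x < real n" using reals_Archimedean2 by blast
    then have "\<delta> / real (n + 2) < x" using that \<delta>_pos by (simp add: field_simps)
    then show ?thesis ..
  qed
  ultimately show ?thesis
    by (intro exI[of _ "C (\<delta> / 2)"]) (auto elim!: eventually_mono)
qed

lemma Df_pos_norm0_eq: "Df_pos_norm0 \<delta> k = (SUP x\<in>{0<..<\<delta>}. ennreal (rise x))"
proof -
  have "((\<lambda>x. Df_pos_norm x \<delta> k) \<longlongrightarrow> (SUP x\<in>{0<..<\<delta>}. Df_pos_norm x \<delta> k)) (at_right 0)"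
    by (rule tendsto_SUP_at_right_0[OF \<delta>_pos])
      (auto simp: Df_pos_norm_eq intro!: ennreal_leI rise_fall_antimono)
  then have "Df_pos_norm0 \<delta> k = (SUP x\<in>{0<..<\<delta>}. Df_pos_norm x \<delta> k)"
    unfolding Df_pos_norm0_def by (intro tendsto_Lim) auto
  also have "\<dots> = (SUP x\<in>{0<..<\<delta>}. ennreal (rise x))"
    by (intro SUP_cong) (auto simp: Df_pos_norm_eq)
  finally show ?thesis .
qed

lemma BV_norm0_eq: "BV_norm0 \<delta> k = (SUP x\<in>{0<..<\<delta>}. ennreal (rise x + fall x))"
proof -
  have "((\<lambda>x. BV_norm x \<delta> k) \<longlongrightarrow> (SUP x\<in>{0<..<\<delta>}. BV_norm x \<delta> k)) (at_right 0)"
    by (rule tendsto_SUP_at_right_0[OF \<delta>_pos])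
      (auto simp: BV_norm_eq intro!: ennreal_leI add_mono rise_fall_antimono)
  then have "BV_norm0 \<delta> k = (SUP x\<in>{0<..<\<delta>}. BV_norm x \<delta> k)"
    unfolding BV_norm0_def by (intro tendsto_Lim) auto
  also have "\<dots> = (SUP x\<in>{0<..<\<delta>}. ennreal (rise x + fall x))"
    by (intro SUP_cong) (auto simp: BV_norm_eq)
  finally show ?thesis .
qed

text \<open>Right-continuity and the limit at \<open>0\<close> are read off the representation: both monotone
  functions in it are right-continuous, and they are bounded.\<close>
lemma finite_limit_if_BV_norm0_finite:
  assumes "BV_norm0 \<delta> k < \<infinity>"
  shows "finite_limit_at_0 \<delta> k"
proof -
  obtain B where B: "\<And>x. 0 < x \<Longrightarrow> x < \<delta> \<Longrightarrow> rise x + fall x \<le> B"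
    using assms unfolding BV_norm0_eq SUP_ennreal_less_top_iff by (metis greaterThanLessThan_iff)
  obtain C where C: "AE x in lborel. x \<in> {0<..<\<delta>} \<longrightarrow> k x = C - rise x + fall x"
    using representation by blast
  obtain lr where lr: "(rise \<longlongrightarrow> lr) (at_right 0)"
  proof (atomize_elim, rule convergent_at_right_0_if_antimono_bounded[OF \<delta>_pos])
    show "rise x \<le> B" if "0 < x" "x < \<delta>" for x
      using B[OF that] fall_nonneg[of x] by linarith
  qed (rule rise_fall_antimono; linarith)
  obtain lf where lf: "(fall \<longlongrightarrow> lf) (at_right 0)"
  proof (atomize_elim, rule convergent_at_right_0_if_antimono_bounded[OF \<delta>_pos])
    show "fall x \<le> B" if "0 < x" "x < \<delta>" for x
      using B[OF that] rise_nonneg[of x] by linarith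
  qed (rule rise_fall_antimono; linarith)
  have "right_continuous_version_on 0 \<delta> k (\<lambda>x. C - rise x + fall x)"
    unfolding right_continuous_version_on_def
  proof (intro conjI ballI)
    show "AE x in lborel. x \<in> {0<..<\<delta>} \<longrightarrow> C - rise x + fall x = k x"
      using C by eventually_elim auto
    show "continuous (at_right x) (\<lambda>x. C - rise x + fall x)" if "x \<in> {0<..<\<delta>}" for x
      using that by (intro continuous_intros continuous_rise_fall[of "x / 2"]) auto
  qed
  moreover have "((\<lambda>x. C - rise x + fall x) \<longlongrightarrow> C - lr + lf) (at_right 0)"
    by (intro tendsto_intros lr lf)
  ultimately show ?thesis
    unfolding finite_limit_at_0_def by blast
qed

text \<open>If the rises have finite total mass but the variation is infinite, then the falls have infinite
  mass, and towards \<open>0\<close> the density climbs above every level.\<close>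
lemma arbitrarily_large_if_BV_norm0_infinite:
  assumes "Df_pos_norm0 \<delta> k < \<infinity>" "\<not> BV_norm0 \<delta> k < \<infinity>"
  shows "\<exists>\<eta>. 0 < \<eta> \<and> \<eta> < \<delta> \<and> (AE x in lborel. x \<in> {0<..<\<eta>} \<longrightarrow> K \<le> k x)"
proof -
  obtain R where R: "\<And>x. 0 < x \<Longrightarrow> x < \<delta> \<Longrightarrow> rise x \<le> R"
    using assms(1) unfolding Df_pos_norm0_eq SUP_ennreal_less_top_iff
    by (metis greaterThanLessThan_iff)
  obtain C where C: "AE x in lborel. x \<in> {0<..<\<delta>} \<longrightarrow> k x = C - rise x + fall x"
    using representation by blast
  obtain \<eta> where \<eta>: "0 < \<eta>" "\<eta> < \<delta>" "R + (K - C + R) < rise \<eta> + fall \<eta>"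
    using assms(2) unfolding BV_norm0_eq SUP_ennreal_less_top_iff
    by (metis greaterThanLessThan_iff not_le)
  have "AE x in lborel. x \<in> {0<..<\<eta>} \<longrightarrow> K \<le> k x"
    using C
  proof eventually_elim
    case (elim x)
    show ?case
    proof
      assume x: "x \<in> {0<..<\<eta>}"
      have "fall \<eta> \<le> fall x" using x \<eta> by (intro rise_fall_antimono) auto
      moreover have "rise x \<le> R" "rise \<eta> \<le> R" using x \<eta> R by auto
      moreover have "k x = C - rise x + fall x" using elim x \<eta> by auto
      ultimately show "K \<le> k x" using \<eta>(3) by linarith
    qed
  qed
  with \<eta> show ?thesis by blast
qed

end

lemma bounded_near_0_if_finite_limit:
  assumes "finite_limit_at_0 \<delta> k" "0 < \<delta>"
  shows "\<exists>K \<eta>. 0 < K \<and> 0 < \<eta> \<and> \<eta> < \<delta> \<and> (AE x in lborel. x \<in> {0<..<\<eta>} \<longrightarrow> k x \<le> K)"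
proof -
  obtain g l where g: "right_continuous_version_on 0 \<delta> k g" "(g \<longlongrightarrow> l) (at_right 0)"
    using assms(1) by (auto simp: finite_limit_at_0_def)
  have "\<forall>\<^sub>F x in at_right 0. g x < \<bar>l\<bar> + 1"
    using g(2) by (rule order_tendstoD) auto
  then obtain b where b: "0 < b" "\<And>x. 0 < x \<Longrightarrow> x < b \<Longrightarrow> g x < \<bar>l\<bar> + 1"
    by (auto simp: eventually_at_right_field)
  have "AE x in lborel. x \<in> {0<..<\<delta>} \<longrightarrow> g x = k x"
    using g(1) by (simp add: right_continuous_version_on_def)
  then have "AE x in lborel. x \<in> {0<..<min b (\<delta> / 2)} \<longrightarrow> k x \<le> \<bar>l\<bar> + 1"
    by eventually_elim (use b(2) assms(2) in force)
  then show ?thesis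
    using b(1) assms(2) by (intro exI[of _ "\<bar>l\<bar> + 1"] exI[of _ "min b (\<delta> / 2)"]) auto
qed

section \<open>The modulus of the characteristic function\<close>

text \<open>One rational bound for the two regimes \<open>1 - cos t \<le> t\<close> and \<open>1 - cos t \<le> 2\<close>, chosen so
  that the majorant of \<open>(1 - cos (u x)) / x\<close> has the logarithm as an explicit primitive.\<close>
lemma one_minus_cos_le:
  fixes t :: real
  assumes "0 \<le> t"
  shows "(1 - cos t) * (1 + t) \<le> 3 * t"
proof -
  have "1 - cos t = 2 * (sin (t / 2))\<^sup>2"
    using cos_double_sin[of "t / 2"] by simp
  also have "\<dots> \<le> 2 * \<bar>sin (t / 2)\<bar>"
    using mult_left_le[of "\<bar>sin (t / 2)\<bar>" "\<bar>sin (t / 2)\<bar>"] by (simp add: power2_eq_square)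
  also have "\<dots> \<le> t"
    using abs_sin_x_le_abs_x[of "t / 2"] assms by simp
  finally have "1 - cos t \<le> t" .
  moreover have "(1 - cos t) * t \<le> 2 * t"
    using assms cos_ge_minus_one[of t] by (intro mult_right_mono) linarith+
  ultimately show ?thesis by (simp add: algebra_simps)
qed

lemma nn_integral_one_minus_cos_div_le:
  assumes "0 \<le> u" "0 < \<eta>"
  shows "(\<integral>\<^sup>+x\<in>{0<..<\<eta>}. ennreal ((1 - cos (u * x)) / x) \<partial>lborel) \<le> ennreal (3 * ln (1 + u * \<eta>))"
proof -
  have pos: "0 < 1 + u * x" if "0 \<le> x" for x
    using assms that by (simp add: add_pos_nonneg)
  have "(\<integral>\<^sup>+x\<in>{0<..<\<eta>}. ennreal ((1 - cos (u * x)) / x) \<partial>lborel) \<le>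
      (\<integral>\<^sup>+x\<in>{0..\<eta>}. ennreal (3 * u / (1 + u * x)) \<partial>lborel)"
  proof (intro nn_integral_mono)
    fix x
    have "(1 - cos (u * x)) / x \<le> 3 * u / (1 + u * x)" if "0 < x"
      using one_minus_cos_le[of "u * x"] assms that pos[of x] by (simp add: field_simps)
    then show "ennreal ((1 - cos (u * x)) / x) * indicator {0<..<\<eta>} x \<le>
        ennreal (3 * u / (1 + u * x)) * indicator {0..\<eta>} x"
      by (auto simp: indicator_def intro: ennreal_leI)
  qed
  also have "\<dots> = ennreal (3 * ln (1 + u * \<eta>) - 3 * ln (1 + u * 0))"
    using assms pos
    by (intro nn_integral_FTC_Icc)
      (auto intro!: derivative_eq_intros simp: less_imp_le pos less_imp_neq[symmetric])
  finally show ?thesis by simp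
qed

text \<open>The oscillating part of the integrand contributes only a bounded amount, as integration by parts
  shows: \<open>sin (u x) / (u x)\<close> has derivative \<open>cos (u x) / x - sin (u x) / (u x\<^sup>2)\<close>. Adding
  \<open>1 / (u x)\<close> makes the remaining term \<open>(sin (u x) - 1) / (u x\<^sup>2)\<close> nonpositive, and the
  integrand dominates the derivative of an explicit function that grows like the logarithm.\<close>
lemma nn_integral_one_minus_cos_div_ge:
  assumes "0 < u" "1 / u \<le> \<eta>"
  shows "ennreal (ln (u * \<eta>) - 2) \<le> (\<integral>\<^sup>+x\<in>{1 / u..\<eta>}. ennreal ((1 - cos (u * x)) / x) \<partial>lborel)"
proof -
  let ?G = "\<lambda>x. ln x - sin (u * x) / (u * x) + 1 / (u * x)"
  let ?g = "\<lambda>x. (1 - cos (u * x)) / x + (sin (u * x) - 1) / (u * x ^ 2)"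
  let ?I = "{1 / u..\<eta>}"
  have x: "0 < x" if "x \<in> ?I" for x
    using assms that by (auto intro: less_le_trans[of _ "1 / u"])
  have G: "(?G has_real_derivative ?g x) (at x)" if "1 / u \<le> x" "x \<le> \<eta>" for x
    using x[of x] that assms(1)
    by (auto intro!: derivative_eq_intros simp: field_simps power2_eq_square)
  have g: "set_integrable lborel ?I ?g"
    using x assms(1) by (intro borel_integrable_atLeastAtMost' continuous_intros) (auto dest: x)
  have h: "set_integrable lborel ?I (\<lambda>x. (1 - cos (u * x)) / x)"
    using x by (intro borel_integrable_atLeastAtMost' continuous_intros) (auto dest: x)
  have "ln (u * \<eta>) - 2 \<le> ?G \<eta> - ?G (1 / u)"
  proof -
    have "0 < \<eta>" using x[of \<eta>] assms(2) by simp
    have "0 \<le> (1 - sin (u * \<eta>)) / (u * \<eta>)"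
      using assms(1) \<open>0 < \<eta>\<close> by simp
    then have "0 \<le> 1 / (u * \<eta>) - sin (u * \<eta>) / (u * \<eta>)"
      by (simp only: diff_divide_distrib)
    moreover have "?G (1 / u) = - ln u - sin 1 + 1" "ln (u * \<eta>) = ln u + ln \<eta>"
      using assms(1) \<open>0 < \<eta>\<close> by (simp_all add: ln_mult ln_div)
    moreover have "- 1 \<le> sin (1::real)" by (rule sin_ge_minus_one)
    ultimately show ?thesis by linarith
  qed
  also have "\<dots> = (LINT x|lborel. ?g x * indicator ?I x)"
  proof (rule integral_FTC_Icc_real[symmetric])
    show "isCont ?g x" if "1 / u \<le> x" "x \<le> \<eta>" for x
      using x[of x] that assms(1) by (intro continuous_intros) auto
  qed (use G assms(2) in auto)
  also have "\<dots> \<le> (LINT x|lborel. (1 - cos (u * x)) / x * indicator ?I x)"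
  proof (rule integral_mono)
    show "integrable lborel (\<lambda>x. ?g x * indicator ?I x)"
      "integrable lborel (\<lambda>x. (1 - cos (u * x)) / x * indicator ?I x)"
      using g h by (simp_all add: set_integrable_def mult.commute)
    fix x
    have "(sin (u * x) - 1) / (u * x ^ 2) \<le> 0"
      using assms(1) by (intro divide_nonpos_nonneg) auto
    then show "?g x * indicator ?I x \<le> (1 - cos (u * x)) / x * indicator ?I x"
      by (intro mult_right_mono) auto
  qed
  finally have "ennreal (ln (u * \<eta>) - 2) \<le> ennreal (LINT x|lborel. (1 - cos (u * x)) / x * indicator ?I x)"
    by (rule ennreal_leI)
  also have "\<dots> = (\<integral>\<^sup>+x. ennreal ((1 - cos (u * x)) / x * indicator ?I x) \<partial>lborel)"
    using h x by (intro nn_integral_eq_integral[symmetric])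
      (auto simp: set_integrable_def mult.commute indicator_def less_imp_le)
  also have "\<dots> = (\<integral>\<^sup>+x\<in>?I. ennreal ((1 - cos (u * x)) / x) \<partial>lborel)"
    by (intro nn_integral_cong) (auto simp: indicator_def)
  finally show ?thesis .
qed

lemma integrable_levy_bound:
  assumes \<nu>: "levy_measure \<nu>" and f: "f \<in> borel_measurable borel"
    and le: "\<And>x. norm (f x) \<le> c * min 1 (x\<^sup>2)"
  shows "integrable \<nu> (f :: real \<Rightarrow> 'a::{banach, second_countable_topology})"
proof -
  have [measurable_cong]: "sets \<nu> = sets borel" using \<nu> by (simp add: levy_measure_def)
  note [measurable] = f
  have "integrable \<nu> (\<lambda>x::real. min 1 (x\<^sup>2))"
    using \<nu> by (intro integrableI_nonneg) (auto simp: levy_measure_def)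
  then have "integrable \<nu> (\<lambda>x. c * min 1 (x\<^sup>2))" by (rule integrable_mult_right)
  then show ?thesis
  proof (rule Bochner_Integration.integrable_bound)
    show "AE x in \<nu>. norm (f x) \<le> norm (c * min 1 (x\<^sup>2))"
      unfolding real_norm_def by (intro AE_I2 order_trans[OF le abs_ge_self])
  qed measurable
qed

text \<open>Second-order Taylor expansion inside \<open>[-1, 1]\<close> and the trivial bound outside.\<close>
lemma levy_integrand_bound:
  "cmod (iexp (u * x) - 1 - \<i> * complex_of_real (u * x * indicator {-1..1} x)) \<le>
    (2 + u\<^sup>2) * min 1 (x\<^sup>2)"
proof (cases "x \<in> {-1..1}")
  case True
  have "cmod (iexp (u * x) - 1 - \<i> * complex_of_real (u * x)) \<le> \<bar>u * x\<bar>\<^sup>2 / 2"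
    using iexp_approx1[of "u * x" 1] by (simp add: diff_diff_eq fact_2 numeral_2_eq_2)
  also have "\<dots> \<le> (2 + u\<^sup>2) * x\<^sup>2"
    by (simp add: power_mult_distrib algebra_simps)
  also have "x\<^sup>2 = min 1 (x\<^sup>2)"
    using True abs_square_le_1[of x] by (simp add: min_absorb2 abs_le_iff)
  finally show ?thesis using True by simp
next
  case False
  then have "1 \<le> x\<^sup>2" using abs_square_le_1[of x] by (auto simp: abs_le_iff)
  have "cmod (iexp (u * x) - 1) \<le> cmod (iexp (u * x)) + cmod 1"
    by (rule norm_triangle_ineq4)
  also have "\<dots> \<le> 2 + u\<^sup>2" by simp
  finally show ?thesis using False \<open>1 \<le> x\<^sup>2\<close> by (simp add: min_absorb1)
qed

lemma integrable_one_minus_cos: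
  assumes "levy_measure \<nu>"
  shows "integrable \<nu> (\<lambda>x. 1 - cos (u * x))"
proof (rule integrable_levy_bound[OF assms])
  fix x
  have "\<bar>Re (iexp (u * x) - 1 - \<i> * complex_of_real (u * x * indicator {-1..1} x))\<bar> \<le>
      (2 + u\<^sup>2) * min 1 (x\<^sup>2)"
    by (rule order_trans[OF abs_Re_le_cmod levy_integrand_bound])
  then show "norm (1 - cos (u * x)) \<le> (2 + u\<^sup>2) * min 1 (x\<^sup>2)"
    by (simp add: Re_exp)
qed simp

text \<open>Drift and compensator are purely imaginary in the exponent, so they do not affect the
  modulus.\<close>
lemma cmod_char_eq:
  assumes "has_characteristic_triplet \<mu> s2 \<gamma> \<nu>"
  shows "cmod (char \<mu> u) = exp (- (s2 / 2 * u\<^sup>2 + (LINT x|\<nu>. 1 - cos (u * x))))"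
proof -
  let ?f = "\<lambda>x. iexp (u * x) - 1 - \<i> * complex_of_real (u * x * indicator {-1..1} x)"
  have \<nu>: "levy_measure \<nu>"
    and char: "char \<mu> u = exp (- complex_of_real (s2 / 2 * u\<^sup>2) + \<i> * complex_of_real (\<gamma> * u) + (CLINT x|\<nu>. ?f x))"
    using assms by (auto simp: has_characteristic_triplet_def)
  have "integrable \<nu> ?f"
    by (rule integrable_levy_bound[OF \<nu> _ levy_integrand_bound]) simp
  then have "Re (CLINT x|\<nu>. ?f x) = (LINT x|\<nu>. Re (?f x))"
    by (simp only: integral_Re)
  also have "\<dots> = (LINT x|\<nu>. - (1 - cos (u * x)))"
    by (intro Bochner_Integration.integral_cong) (auto simp: Re_exp)
  also have "\<dots> = - (LINT x|\<nu>. 1 - cos (u * x))"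
    by (rule Bochner_Integration.integral_minus)
  finally show ?thesis
    unfolding char norm_exp_eq_Re by simp
qed

text \<open>The sets \<open>A\<close> and \<open>- A\<close> overlap at most in \<open>0\<close>, which is a null set.\<close>
lemma symmetrized_jump_measure_eq_distr_abs:
  assumes \<nu>: "levy_measure \<nu>"
  shows "symmetrized_jump_measure \<nu> = distr \<nu> (restrict_space borel {0..}) abs"
proof (rule measure_eqI)
  have sets_\<nu>: "sets \<nu> = sets borel" and null: "{0} \<in> null_sets \<nu>"
    using \<nu> by (auto simp: levy_measure_def null_sets_def)
  have space: "space \<nu> = UNIV" using sets_eq_imp_space_eq[OF sets_\<nu>] by simp
  have sa: "sigma_algebra {0::real..} (sets (restrict_space borel {0..}))"
    using sets.sigma_algebra_axioms[of "restrict_space borel {0::real..}"] by (simp add: space_restrict_space)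
  have sets: "sets (symmetrized_jump_measure \<nu>) = sets (restrict_space borel {0..})"
    unfolding symmetrized_jump_measure_def
    using sets.space_closed[of "restrict_space borel {0::real..}"] sigma_algebra.sigma_sets_eq[OF sa]
    by (subst sets_measure_of) (auto simp: space_restrict_space)
  then show "sets (symmetrized_jump_measure \<nu>) = sets (distr \<nu> (restrict_space borel {0..}) abs)"
    by simp
  fix A assume "A \<in> sets (symmetrized_jump_measure \<nu>)"
  then have A: "A \<in> sets borel" "A \<subseteq> {0..}"
    by (auto simp: sets sets_restrict_space)
  have abs: "abs \<in> measurable \<nu> (restrict_space borel {0..})"
    by (rule measurable_restrict_space2) (auto simp: measurable_cong_sets[OF sets_\<nu> refl])
  have neg: "uminus ` A = uminus -` A"
    by (auto simp: image_iff) (metis minus_minus)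
  have neg_sets: "uminus -` A \<in> sets borel"
    using measurable_sets[OF borel_measurable_uminus[OF measurable_ident] A(1)] by simp
  have "(A - {0}) \<inter> (uminus -` A - {0}) = {}"
  proof (rule equals0I)
    fix x assume "x \<in> (A - {0}) \<inter> (uminus -` A - {0})"
    then have "x \<noteq> 0" "0 \<le> x" "0 \<le> - x" using A(2) by auto
    then show False by linarith
  qed
  then have "emeasure \<nu> (A - {0}) + emeasure \<nu> (uminus -` A - {0}) =
      emeasure \<nu> ((A - {0}) \<union> (uminus -` A - {0}))"
    using A neg_sets by (intro plus_emeasure) (auto simp: sets_\<nu>)
  also have "(A - {0}) \<union> (uminus -` A - {0}) = abs -` A - {0}"
    using A(2) by (auto simp: abs_if split: if_splits)
  finally have "emeasure \<nu> A + emeasure \<nu> (uminus -` A) = emeasure \<nu> (abs -` A)"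
    using A(1) neg_sets measurable_sets[OF borel_measurable_abs[OF measurable_ident] A(1)] null
    by (simp add: emeasure_Diff_null_set sets_\<nu>)
  then show "emeasure (symmetrized_jump_measure \<nu>) A =
      emeasure (distr \<nu> (restrict_space borel {0..}) abs) A"
    using A abs by (simp add: emeasure_symmetrized_jump_measure[OF sets_\<nu>] neg emeasure_distr
        sets_restrict_space_iff space)
qed

text \<open>Extends the defining identity of the density from sets to functions. Even integrands against
  \<open>\<nu>\<close> become integrals against the density.\<close>
lemma nn_integral_levy_eq_density:
  assumes \<nu>: "levy_measure \<nu>" and k: "x_times_measure_has_density_on (symmetrized_jump_measure \<nu>) S k"
    and S: "S \<in> sets borel" "S \<subseteq> {0..}" and g: "g \<in> borel_measurable borel"
  shows "(\<integral>\<^sup>+x. ennreal \<bar>x\<bar> * g \<bar>x\<bar> * indicator S \<bar>x\<bar> \<partial>\<nu>) =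
    (\<integral>\<^sup>+x. ennreal (k x) * g x * indicator S x \<partial>lborel)"
proof -
  note [measurable] = S(1) g
  have sets_\<nu> [measurable_cong]: "sets \<nu> = sets borel"
    using \<nu> by (auto simp: levy_measure_def)
  have abs: "abs \<in> measurable \<nu> (restrict_space borel {0..})"
    by (rule measurable_restrict_space2) (auto simp: measurable_cong_sets[OF sets_\<nu> refl])
  define k' where "k' x = (if x \<in> S then k x else 0)" for x
  have [measurable]: "k' \<in> borel_measurable borel"
  proof -
    have "k \<in> borel_measurable (restrict_space borel S)"
      using k by (simp add: x_times_measure_has_density_on_def)
    then have "(\<lambda>x. indicator S x *\<^sub>R k x) \<in> borel_measurable borel"
      by (subst (asm) borel_measurable_restrict_space_iff) auto
    moreover have "(\<lambda>x. indicator S x *\<^sub>R k x) = k'"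
      by (auto simp: k'_def indicator_def)
    ultimately show ?thesis by simp
  qed
  have eq: "density (distr \<nu> borel abs) (\<lambda>x. ennreal x * indicator S x) =
      density lborel (\<lambda>x. ennreal (k' x))"
  proof (rule measure_eqI)
    fix A assume "A \<in> sets (density (distr \<nu> borel abs) (\<lambda>x. ennreal x * indicator S x))"
    then have A [measurable]: "A \<in> sets borel" by simp
    have "emeasure (density (distr \<nu> borel abs) (\<lambda>x. ennreal x * indicator S x)) A =
        (\<integral>\<^sup>+x. ennreal \<bar>x\<bar> * indicator (A \<inter> S) \<bar>x\<bar> \<partial>\<nu>)"
      by (subst emeasure_density, simp, simp, subst nn_integral_distr)
        (auto intro!: nn_integral_cong simp: indicator_def)
    also have "\<dots> = (\<integral>\<^sup>+x\<in>A \<inter> S. ennreal x \<partial>symmetrized_jump_measure \<nu>)"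
      unfolding symmetrized_jump_measure_eq_distr_abs[OF \<nu>]
      by (subst nn_integral_distr[OF abs]) (auto intro: measurable_restrict_space1)
    also have "\<dots> = (\<integral>\<^sup>+x\<in>A \<inter> S. ennreal (k x) \<partial>lborel)"
      using k by (simp add: x_times_measure_has_density_on_def)
    also have "\<dots> = emeasure (density lborel (\<lambda>x. ennreal (k' x))) A"
      by (subst emeasure_density, simp, simp, intro nn_integral_cong)
        (auto simp: k'_def indicator_def)
    finally show "emeasure (density (distr \<nu> borel abs) (\<lambda>x. ennreal x * indicator S x)) A =
        emeasure (density lborel (\<lambda>x. ennreal (k' x))) A" .
  qed simp
  have "(\<integral>\<^sup>+x. ennreal \<bar>x\<bar> * g \<bar>x\<bar> * indicator S \<bar>x\<bar> \<partial>\<nu>) =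
      (\<integral>\<^sup>+x. g x \<partial>density (distr \<nu> borel abs) (\<lambda>x. ennreal x * indicator S x))"
    by (subst nn_integral_density, simp, simp, subst nn_integral_distr)
      (auto intro!: nn_integral_cong simp: ac_simps)
  also have "\<dots> = (\<integral>\<^sup>+x. ennreal (k' x) * g x \<partial>lborel)"
    unfolding eq by (subst nn_integral_density) auto
  also have "\<dots> = (\<integral>\<^sup>+x. ennreal (k x) * g x * indicator S x \<partial>lborel)"
    by (intro nn_integral_cong) (auto simp: k'_def indicator_def)
  finally show ?thesis .
qed

text \<open>Jumps of size at least \<open>\<eta>\<close> contribute a bounded amount; those below contribute at most
  \<open>K\<close> times the logarithmically growing integral of \<open>(1 - cos (u x)) / x\<close>.\<close>
lemma levy_exponent_upper_bound:
  assumes \<nu>: "levy_measure \<nu>"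
    and k: "x_times_measure_has_density_on (symmetrized_jump_measure \<nu>) {0<..\<delta>} k"
    and \<eta>: "0 < \<eta>" "\<eta> < \<delta>" "\<delta> < 1"
    and K: "0 < K" "AE x in lborel. x \<in> {0<..<\<eta>} \<longrightarrow> k x \<le> K"
  shows "\<exists>D. \<forall>u. (LINT x|\<nu>. 1 - cos (u * x)) \<le> D + 3 * K * ln (1 + \<bar>u\<bar>)"
proof -
  have [measurable_cong]: "sets \<nu> = sets borel" using \<nu> by (simp add: levy_measure_def)
  \<comment> \<open>Majorizes \<open>1 - cos (u x)\<close> where \<open>\<bar>x\<bar> \<ge> \<eta>\<close>, uniformly in \<open>u\<close>, and is \<open>\<nu>\<close>-integrable.\<close>
  define m where "m x = 2 / \<eta>\<^sup>2 * min 1 (x\<^sup>2)" for x :: real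
  define D where "D = (LINT x|\<nu>. m x)"
  have m: "integrable \<nu> m" "\<And>x. 0 \<le> m x"
    unfolding m_def by (auto intro!: integrable_levy_bound[OF \<nu>, of _ "2 / \<eta>\<^sup>2"])
  have m_large: "2 \<le> m x" if "\<eta> \<le> \<bar>x\<bar>" for x
  proof -
    have "\<eta>\<^sup>2 \<le> 1" using \<eta> by (simp add: abs_square_le_1)
    moreover have "\<eta>\<^sup>2 \<le> x\<^sup>2" using \<eta> that by (metis abs_le_square_iff abs_of_pos)
    ultimately show ?thesis using \<eta> by (simp add: m_def field_simps min_def)
  qed
  have pos: "(LINT x|\<nu>. 1 - cos (u * x)) \<le> D + 3 * K * ln (1 + u)" if u: "0 \<le> u" for u
  proof -
    define g where "g x = ennreal ((1 - cos (u * x)) / x) * indicator {0<..<\<eta>} x" for x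
    have [measurable]: "g \<in> borel_measurable borel" by (simp add: g_def[abs_def])
    have "0 \<le> ln (1 + u)" using u by simp
    have "ennreal (LINT x|\<nu>. 1 - cos (u * x)) = (\<integral>\<^sup>+x. ennreal (1 - cos (u * x)) \<partial>\<nu>)"
      by (intro nn_integral_eq_integral[symmetric] integrable_one_minus_cos[OF \<nu>]) auto
    also have "\<dots> \<le> (\<integral>\<^sup>+x. ennreal \<bar>x\<bar> * g \<bar>x\<bar> * indicator {0<..\<delta>} \<bar>x\<bar> + ennreal (m x) \<partial>\<nu>)"
    proof (intro nn_integral_mono)
      fix x
      consider "x = 0" | "x \<noteq> 0" "\<bar>x\<bar> < \<eta>" | "\<eta> \<le> \<bar>x\<bar>" by linarith
      then show "ennreal (1 - cos (u * x)) \<le>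
          ennreal \<bar>x\<bar> * g \<bar>x\<bar> * indicator {0<..\<delta>} \<bar>x\<bar> + ennreal (m x)"
      proof cases
        case 2
        have "cos (u * \<bar>x\<bar>) = cos (u * x)" by (simp add: abs_if)
        then have "ennreal \<bar>x\<bar> * g \<bar>x\<bar> = ennreal (1 - cos (u * x))"
          using 2 by (simp add: g_def ennreal_mult'[symmetric])
        then show ?thesis using 2 \<eta> by (simp add: add_increasing2)
      next
        case 3
        have "1 - cos (u * x) \<le> m x"
          using m_large[OF 3] cos_ge_minus_one[of "u * x"] by linarith
        then show ?thesis by (intro add_increasing ennreal_leI) auto
      qed simp
    qed
    also have "\<dots> = (\<integral>\<^sup>+x. ennreal \<bar>x\<bar> * g \<bar>x\<bar> * indicator {0<..\<delta>} \<bar>x\<bar> \<partial>\<nu>) + (\<integral>\<^sup>+x. ennreal (m x) \<partial>\<nu>)"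
      using borel_measurable_integrable[OF m(1)] by (intro nn_integral_add) simp_all
    also have "(\<integral>\<^sup>+x. ennreal (m x) \<partial>\<nu>) = ennreal D"
      unfolding D_def using m by (intro nn_integral_eq_integral) auto
    also have "(\<integral>\<^sup>+x. ennreal \<bar>x\<bar> * g \<bar>x\<bar> * indicator {0<..\<delta>} \<bar>x\<bar> \<partial>\<nu>) =
        (\<integral>\<^sup>+x. ennreal (k x) * g x * indicator {0<..\<delta>} x \<partial>lborel)"
      by (intro nn_integral_levy_eq_density[OF \<nu> k]) auto
    also have "\<dots> \<le> (\<integral>\<^sup>+x. ennreal K * g x \<partial>lborel)"
    proof (rule nn_integral_mono_AE)
      show "AE x in lborel. ennreal (k x) * g x * indicator {0<..\<delta>} x \<le> ennreal K * g x"
        using K(2)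
        by eventually_elim (auto simp: g_def indicator_def intro!: mult_right_mono ennreal_leI)
    qed
    also have "\<dots> = ennreal K * (\<integral>\<^sup>+x. g x \<partial>lborel)"
      by (rule nn_integral_cmult) simp
    also have "(\<integral>\<^sup>+x. g x \<partial>lborel) \<le> ennreal (3 * ln (1 + u * \<eta>))"
      unfolding g_def using u \<eta>(1) by (rule nn_integral_one_minus_cos_div_le)
    also have "ennreal (3 * ln (1 + u * \<eta>)) \<le> ennreal (3 * ln (1 + u))"
    proof -
      have "u * \<eta> \<le> u" using u \<eta> by (simp add: mult_left_le)
      moreover have "0 \<le> u * \<eta>" using u \<eta> by simp
      ultimately show ?thesis by (intro ennreal_leI mult_left_mono ln_mono) auto
    qed
    finally have "ennreal (LINT x|\<nu>. 1 - cos (u * x)) \<le> ennreal K * ennreal (3 * ln (1 + u)) + ennreal D"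
      by (simp add: add_right_mono mult_left_mono)
    also have "\<dots> = ennreal (K * (3 * ln (1 + u)) + D)"
      using K(1) \<open>0 \<le> ln (1 + u)\<close> m(2) by (simp add: ennreal_mult' ennreal_plus D_def)
    finally show ?thesis
      using K(1) \<open>0 \<le> ln (1 + u)\<close> m(2)
      by (subst (asm) ennreal_le_iff) (auto simp: D_def algebra_simps)
  qed
  have "(LINT x|\<nu>. 1 - cos (u * x)) \<le> D + 3 * K * ln (1 + \<bar>u\<bar>)" for u
    using pos[of "\<bar>u\<bar>"] by (cases "0 \<le> u") auto
  then show ?thesis by blast
qed

lemma levy_exponent_lower_bound:
  assumes \<nu>: "levy_measure \<nu>"
    and k: "x_times_measure_has_density_on (symmetrized_jump_measure \<nu>) {0<..\<delta>} k"
    and \<eta>: "0 < \<eta>" "\<eta> < \<delta>"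
    and K: "0 \<le> K" "AE x in lborel. x \<in> {0<..<\<eta>} \<longrightarrow> K \<le> k x"
    and u: "2 / \<eta> \<le> u"
  shows "K * (ln (u * (\<eta> / 2)) - 2) \<le> (LINT x|\<nu>. 1 - cos (u * x))"
proof -
  have [measurable_cong]: "sets \<nu> = sets borel" using \<nu> by (simp add: levy_measure_def)
  have "0 < 2 / \<eta>" using \<eta>(1) by simp
  then have u_pos: "0 < u" using u by linarith
  then have u_inverse: "1 / u \<le> \<eta> / 2"
    using u \<eta>(1) by (simp add: field_simps)
  define g where "g x = ennreal ((1 - cos (u * x)) / x) * indicator {1 / u..\<eta> / 2} x" for x
  have [measurable]: "g \<in> borel_measurable borel" by (simp add: g_def[abs_def])
  have supp: "0 < x" if "1 / u \<le> x" for x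
    using that u_pos by (auto intro: less_le_trans[of _ "1 / u"])
  have "ennreal (K * (ln (u * (\<eta> / 2)) - 2)) = ennreal K * ennreal (ln (u * (\<eta> / 2)) - 2)"
    using K(1) by (rule ennreal_mult')
  also have "\<dots> \<le> ennreal K * (\<integral>\<^sup>+x. g x \<partial>lborel)"
    unfolding g_def using u_pos u_inverse by (intro mult_left_mono nn_integral_one_minus_cos_div_ge) auto
  also have "\<dots> = (\<integral>\<^sup>+x. ennreal K * g x \<partial>lborel)"
    by (rule nn_integral_cmult[symmetric]) simp
  also have "\<dots> \<le> (\<integral>\<^sup>+x. ennreal (k x) * g x * indicator {0<..\<delta>} x \<partial>lborel)"
  proof (rule nn_integral_mono_AE)
    show "AE x in lborel. ennreal K * g x \<le> ennreal (k x) * g x * indicator {0<..\<delta>} x"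
      using K(2)
      by eventually_elim
        (use \<eta> in \<open>auto simp: g_def indicator_def dest: supp intro!: mult_right_mono ennreal_leI\<close>)
  qed
  also have "\<dots> = (\<integral>\<^sup>+x. ennreal \<bar>x\<bar> * g \<bar>x\<bar> * indicator {0<..\<delta>} \<bar>x\<bar> \<partial>\<nu>)"
    by (intro nn_integral_levy_eq_density[OF \<nu> k, symmetric]) auto
  also have "\<dots> \<le> (\<integral>\<^sup>+x. ennreal (1 - cos (u * x)) \<partial>\<nu>)"
  proof (intro nn_integral_mono)
    fix x
    have "cos (u * \<bar>x\<bar>) = cos (u * x)" by (simp add: abs_if)
    then show "ennreal \<bar>x\<bar> * g \<bar>x\<bar> * indicator {0<..\<delta>} \<bar>x\<bar> \<le> ennreal (1 - cos (u * x))"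
      by (auto simp: g_def indicator_def ennreal_mult'[symmetric])
  qed
  also have "\<dots> = ennreal (LINT x|\<nu>. 1 - cos (u * x))"
    by (intro nn_integral_eq_integral integrable_one_minus_cos[OF \<nu>]) auto
  finally show ?thesis
    by (subst (asm) ennreal_le_iff) (auto intro: Bochner_Integration.integral_nonneg)
qed

lemma exponent_bound_if_polynomial_decay:
  assumes triplet: "has_characteristic_triplet \<mu> s2 \<gamma> \<nu>"
    and c: "0 < c" and le: "c * (1 + \<bar>u\<bar>) powr (- \<alpha>) \<le> cmod (char \<mu> u)"
  shows "s2 / 2 * u\<^sup>2 + (LINT x|\<nu>. 1 - cos (u * x)) \<le> \<alpha> * ln (1 + \<bar>u\<bar>) - ln c"
proof -
  have "ln (c * (1 + \<bar>u\<bar>) powr (- \<alpha>)) \<le> ln (cmod (char \<mu> u))"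
    using c le by (intro ln_mono) auto
  moreover have "0 < 1 + \<bar>u\<bar>" by linarith
  ultimately show ?thesis
    using c by (simp add: cmod_char_eq[OF triplet] ln_mult ln_powr)
qed

section \<open>The equivalence\<close>

theorem theorem3:
  fixes \<mu> \<nu> :: "real measure" and s2 \<gamma> \<delta> :: real and k\<^sub>s :: "real \<Rightarrow> real"
  assumes "infinitely_divisible \<mu>"
    and "has_characteristic_triplet \<mu> s2 \<gamma> \<nu>"
    and "0 < \<delta>" and "\<delta> < 1"
    and "x_times_measure_has_density_on (symmetrized_jump_measure \<nu>) {0<..\<delta>} k\<^sub>s"
    and "\<And>\<epsilon>. 0 < \<epsilon> \<Longrightarrow> \<epsilon> < \<delta> \<Longrightarrow> k\<^sub>s \<in> BV \<epsilon> \<delta>"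
    and "Df_pos_norm0 \<delta> k\<^sub>s < \<infinity>"
  shows "((s2 = 0 \<and> BV_norm0 \<delta> k\<^sub>s < \<infinity>) \<longleftrightarrow> (s2 = 0 \<and> finite_limit_at_0 \<delta> k\<^sub>s)) \<and>
    ((s2 = 0 \<and> finite_limit_at_0 \<delta> k\<^sub>s) \<longleftrightarrow>
      (\<exists>\<alpha>>0. \<exists>c>0. \<forall>u. cmod (char \<mu> u) \<ge> c * (1 + \<bar>u\<bar>) powr (- \<alpha>)))"
    (is "(?i \<longleftrightarrow> ?ii) \<and> (?ii \<longleftrightarrow> ?iii)")
proof -
  note triplet = assms(2) and density = assms(5)
  have \<nu>: "levy_measure \<nu>" and s2: "0 \<le> s2"
    using triplet by (auto simp: has_characteristic_triplet_def)
  interpret BV_away_from_0 "k\<^sub>s" \<delta>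
    by unfold_locales (use assms in auto)
  have "?i \<Longrightarrow> ?ii"
    using finite_limit_if_BV_norm0_finite by blast
  moreover have "?ii \<Longrightarrow> ?iii"
  proof -
    assume ii: ?ii
    then obtain K \<eta> where K: "0 < K" "0 < \<eta>" "\<eta> < \<delta>"
      "AE x in lborel. x \<in> {0<..<\<eta>} \<longrightarrow> k\<^sub>s x \<le> K"
      using bounded_near_0_if_finite_limit assms(3) by blast
    obtain D where D: "\<And>u. (LINT x|\<nu>. 1 - cos (u * x)) \<le> D + 3 * K * ln (1 + \<bar>u\<bar>)"
      using levy_exponent_upper_bound[OF \<nu> density K(2,3) assms(4) K(1,4)] by blast
    have "exp (- D) * (1 + \<bar>u\<bar>) powr (- (3 * K)) \<le> cmod (char \<mu> u)" for u
    proof -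
      have "exp (- D) * (1 + \<bar>u\<bar>) powr (- (3 * K)) = exp (- (D + 3 * K * ln (1 + \<bar>u\<bar>)))"
        by (simp add: powr_def mult_exp_exp)
      also have "\<dots> \<le> cmod (char \<mu> u)"
        unfolding cmod_char_eq[OF triplet] using ii D[of u] by simp
      finally show ?thesis .
    qed
    then show ?iii
      using K(1) by (intro exI[of _ "3 * K"] conjI exI[of _ "exp (- D)"]) auto
  qed
  \<comment> \<open>A Gaussian part would make the exponent grow quadratically; infinite variation would make the
    density unbounded at \<open>0\<close>. Either contradicts a logarithmically growing exponent.\<close>
  moreover have "?iii \<Longrightarrow> ?i"
  proof -
    assume ?iii
    then obtain \<alpha> c where \<alpha>: "0 < \<alpha>" "0 < c"
      and decay: "\<And>u. c * (1 + \<bar>u\<bar>) powr (- \<alpha>) \<le> cmod (char \<mu> u)" by auto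
    note bound = exponent_bound_if_polynomial_decay[OF triplet \<alpha>(2) decay]
    have J: "0 \<le> (LINT x|\<nu>. 1 - cos (u * x))" for u
      by (intro Bochner_Integration.integral_nonneg) auto
    have "s2 = 0"
    proof (rule ccontr)
      assume "s2 \<noteq> 0"
      then have "0 < s2" using s2 by simp
      then have "filterlim (\<lambda>u. s2 / 2 * u\<^sup>2 - \<alpha> * ln (1 + u)) at_top at_top"
        by real_asymp
      then have "\<forall>\<^sub>F u in at_top. - ln c < s2 / 2 * u\<^sup>2 - \<alpha> * ln (1 + u)"
        by (simp add: filterlim_at_top_dense)
      then obtain u where "0 \<le> u" "- ln c < s2 / 2 * u\<^sup>2 - \<alpha> * ln (1 + u)"
        using eventually_happens[OF eventually_conj[OF eventually_ge_at_top[of 0]]] by fastforce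
      then show False using bound[of u] J[of u] by simp
    qed
    moreover have "BV_norm0 \<delta> k\<^sub>s < \<infinity>"
    proof (rule ccontr)
      assume "\<not> BV_norm0 \<delta> k\<^sub>s < \<infinity>"
      from arbitrarily_large_if_BV_norm0_infinite[OF assms(7) this]
      obtain \<eta> where \<eta>: "0 < \<eta>" "\<eta> < \<delta>"
        "AE x in lborel. x \<in> {0<..<\<eta>} \<longrightarrow> \<alpha> + 1 \<le> k\<^sub>s x" by blast
      \<comment> \<open>The growth rate \<open>\<alpha> + 1\<close> of the exponent beats the rate \<open>\<alpha>\<close> that polynomial decay permits.\<close>
      have "filterlim (\<lambda>u. (\<alpha> + 1) * (ln (u * (\<eta> / 2)) - 2) - \<alpha> * ln (1 + u)) at_top at_top"
        using \<alpha>(1) \<eta>(1) by real_asymp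
      then have "\<forall>\<^sub>F u in at_top. - ln c < (\<alpha> + 1) * (ln (u * (\<eta> / 2)) - 2) - \<alpha> * ln (1 + u)"
        by (simp add: filterlim_at_top_dense)
      then obtain u where u: "2 / \<eta> \<le> u"
        "- ln c < (\<alpha> + 1) * (ln (u * (\<eta> / 2)) - 2) - \<alpha> * ln (1 + u)"
        using eventually_happens[OF eventually_conj[OF eventually_ge_at_top[of "2 / \<eta>"]]] by fastforce
      have "0 \<le> u" using u(1) \<eta>(1) by (auto intro: order_trans[of _ "2 / \<eta>"])
      moreover have "(\<alpha> + 1) * (ln (u * (\<eta> / 2)) - 2) \<le> (LINT x|\<nu>. 1 - cos (u * x))"
        using levy_exponent_lower_bound[OF \<nu> density \<eta>(1,2) _ \<eta>(3) u(1)] \<alpha>(1) by simp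
      ultimately show False using bound[of u] u(2) \<open>s2 = 0\<close> by simp
    qed
    ultimately show ?i by blast
  qed
  ultimately show ?thesis by blast
qed

end
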